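(* Consider the subsystem surface code on the $L\times L$ square lattice with open boundary conditions, with $n=3L^2+4L+1$ qubits and group $\mathcal S$ generated by all $S^X_p$, $S^Z_p$ and all boundary operators $S_e$, as defined in the context. Then $\mathcal S$ is abelian with $s=2L^2+4L$ independent generators and defines a stabilizer code encoding $k'=n-s=L^2+1$ qubits. The boundary operators $S_e$ commute with all triangle operators $G(T)$. The encoded qubits split into $g=L^2$ gauge qubits, one per plaquette $p$, with logical Pauli operators $\overline X_p=G(T^{SW}_p)$, $\overline Z_p=G(T^{SE}_p)$, and $k=k'-g=1$ logical qubit, whose logical Pauli operators can be chosen as $\overline X_1=\prod_{j\in\Gamma}X_j$ and $\overline Z_1=\prod_{j\in\Lambda}Z_j$ (a horizontal line of $X$'s and a vertical line of $Z$'s). By contrast, a vertical line of $X$'s, $\prod_{j\in\Lambda}X_j$, and a horizontal line of $Z$'s, $\prod_{j\in\Gamma}Z_j$, are not logical operators, because they anti-commute with some of the boundary stabilizers $S_e$. The code has minimum distance $d=L$.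
   Context: Lattice: the square lattice of size $L\times L$ with open boundary conditions, with $(L+1)^2$ vertices $(x,y)$, $0\le x,y\le L$ ($x$ increasing to the east, $y$ to the north), $2L(L+1)$ edges and $L^2$ plaquettes. One qubit sits at every vertex and one at the centre of every edge. Triangles: each plaquette $p$ has four triangles $T^{SW}_p,T^{SE}_p,T^{NW}_p,T^{NE}_p$, one at each of its corners (south-west, south-east, north-west, north-east); the triangle at a given corner $u$ of $p$ is $T=(u,f,g)$, where $f,g$ are the two edges of $p$ incident to $u$. Triangle operators: $G(T)=X_uX_fX_g$ if $T$ is SW or NE, and $G(T)=Z_uZ_fZ_g$ if $T$ is SE or NW, where subscripts indicate the qubits acted on. Plaquette stabilizers: $S^X_p=G(T^{SW}_p)G(T^{NE}_p)$, $S^Z_p=G(T^{SE}_p)G(T^{NW}_p)$. Boundary stabilizers: for each edge $e$ on the boundary of the lattice there is a weight-two operator $S_e$ acting on the qubit of $e$ and on one endpoint of $e$: on the left boundary $S_e=X_eX_v$ with $v$ the upper endpoint of $e$; on the right boundary $S_e=X_eX_v$ with $v$ the lower endpoint; on the top boundary $S_e=Z_eZ_v$ with $v$ the right endpoint; on the bottom boundary $S_e=Z_eZ_v$ with $v$ the left endpoint. $\Gamma$ (resp. $\Lambda$) is the set of all qubits (vertices and edges) lying on some fixed horizontal (resp. vertical) line of the lattice, from boundary to boundary. The minimum distance of a subsystem code is the minimum weight (number of qubits acted on non-trivially) of a Pauli error $E$ that commutes with all stabilizers and implements a non-trivial transformation on the logical qubits (here: anti-commutes with $\overline X_1$ or $\overline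 Z_1$).
   Formalization: The minimum distance is stated and proved as d = L+1 instead of d = L, which is false for every L ≥ 1 on this lattice: the L+1 disjoint parallel lines are equivalent modulo the stabilizers, so an error must meet all of them (for L = 1 the distance is 2). *)

theory Defs
  imports Complex_Main "HOL-Library.Function_Algebras" "HOL-Algebra.Generated_Groups"
begin

section \<open>Pauli operators and stabilizer codes on a set of qubits\<close>

text \<open>
  Qubits are labelled by elements of a type \<open>'q\<close>. A state is its family of amplitudes over the
  computational basis; the basis state \<open>c\<close> has qubit \<open>j\<close> in state 1 iff \<open>c j\<close>. The states of
  the qubits in a finite set \<open>Q\<close> are those supported on basis states vanishing outside \<open>Q\<close>
  (all other qubits are in state 0), a space of dimension \<open>2 ^ card Q\<close>.
\<close>

type_synonym 'q state = "('q \<Rightarrow> bool) \<Rightarrow> complex"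
type_synonym 'q operator = "'q state \<Rightarrow> 'q state"

definition states_on :: "'q set \<Rightarrow> 'q state set" where
  "states_on Q = {\<psi>. \<forall>c. \<psi> c \<noteq> 0 \<longrightarrow> (\<forall>j. c j \<longrightarrow> j \<in> Q)}"

datatype pauli = PI | PX | PY | PZ

fun pauli_mat :: "pauli \<Rightarrow> bool \<Rightarrow> bool \<Rightarrow> complex" where
  "pauli_mat PI a b = (if a = b then 1 else 0)"
| "pauli_mat PX a b = (if a = b then 0 else 1)"
| "pauli_mat PY a b = (if a = b then 0 else if a then \<i> else - \<i>)"
| "pauli_mat PZ a b = (if a = b then (if a then - 1 else 1) else 0)"

definition pauli_at :: "pauli \<Rightarrow> 'q \<Rightarrow> 'q operator" where
  "pauli_at P j \<psi> = (\<lambda>c. \<Sum>b\<in>UNIV. pauli_mat P (c j) b * \<psi> (c(j := b)))"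

text \<open>
  The product of the single-qubit operators prescribed by \<open>E\<close>. The order is irrelevant, since
  operators on different qubits commute; only finitely supported \<open>E\<close> are meaningful.
\<close>

definition pauli_support :: "('q \<Rightarrow> pauli) \<Rightarrow> 'q set" where
  "pauli_support E = {j. E j \<noteq> PI}"

definition pauli_string :: "('q \<Rightarrow> pauli) \<Rightarrow> 'q operator" where
  "pauli_string E = Finite_Set.fold (\<lambda>j A. pauli_at (E j) j \<circ> A) id (pauli_support E)"

definition weight :: "('q \<Rightarrow> pauli) \<Rightarrow> nat" where
  "weight E = card (pauli_support E)"

definition X_on :: "'q set \<Rightarrow> 'q operator" where
  "X_on A = pauli_string (\<lambda>j. if j \<in> A then PX else PI)"

definition Z_on :: "'q set \<Rightarrow> 'q operator" where
  "Z_on A = pauli_string (\<lambda>j. if j \<in> A then PZ else PI)"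

definition phase :: "nat \<Rightarrow> 'q operator" where
  "phase k \<psi> = (\<lambda>c. \<i> ^ k * \<psi> c)"

definition pauli_group :: "'q set \<Rightarrow> 'q operator monoid" where
  "pauli_group Q =
     \<lparr>carrier = {phase k \<circ> pauli_string E | k E. pauli_support E \<subseteq> Q}, mult = (\<circ>), one = id\<rparr>"

definition commute :: "'q operator \<Rightarrow> 'q operator \<Rightarrow> bool" where
  "commute A B \<longleftrightarrow> A \<circ> B = B \<circ> A"

definition anticommute :: "'q operator \<Rightarrow> 'q operator \<Rightarrow> bool" where
  "anticommute A B \<longleftrightarrow> A \<circ> B = - (B \<circ> A)"

definition independent_generators :: "'q set \<Rightarrow> 'q operator set \<Rightarrow> bool" where
  "independent_generators Q G \<longleftrightarrow> (\<forall>A\<in>G. A \<notin> generate (pauli_group Q) (G - {A}))"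

definition code_space :: "'q set \<Rightarrow> 'q operator set \<Rightarrow> 'q state set" where
  "code_space Q S = {\<psi> \<in> states_on Q. \<forall>A\<in>S. A \<psi> = \<psi>}"

definition complex_dim :: "'q state set \<Rightarrow> nat" where
  "complex_dim V = vector_space.dim (\<lambda>(a::complex) \<psi> c. a * \<psi> c) V"

text \<open>\<open>S\<close> is the stabilizer group of a code on the qubits \<open>Q\<close> that encodes \<open>k\<close> qubits.\<close>

definition stabilizer_code :: "'q set \<Rightarrow> 'q operator set \<Rightarrow> nat \<Rightarrow> bool" where
  "stabilizer_code Q S k \<longleftrightarrow>
     subgroup S (pauli_group Q) \<and> (\<forall>A\<in>S. \<forall>B\<in>S. commute A B) \<and> - id \<notin> S \<and>
     complex_dim (code_space Q S) = 2 ^ k"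

definition logical_operators :: "'q set \<Rightarrow> 'q operator set \<Rightarrow> 'q operator set" where
  "logical_operators Q S = {A \<in> carrier (pauli_group Q). \<forall>B\<in>S. commute A B}"

text \<open>
  \<open>Xb\<close>, \<open>Zb\<close> are the logical Pauli operators of encoded qubits labelled by \<open>J\<close>: they satisfy the
  relations of the Pauli operators of \<open>J\<close>, and together with \<open>S\<close> and the phases they generate all
  logical operators, so that no encoded qubit is left out.
\<close>

definition logical_paulis ::
    "'q set \<Rightarrow> 'q operator set \<Rightarrow> 'j set \<Rightarrow> ('j \<Rightarrow> 'q operator) \<Rightarrow> ('j \<Rightarrow> 'q operator) \<Rightarrow> bool" where
  "logical_paulis Q S J Xb Zb \<longleftrightarrow>
     (\<forall>i\<in>J. Xb i \<in> logical_operators Q S \<and> Zb i \<in> logical_operators Q S) \<and>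
     (\<forall>i\<in>J. Xb i \<circ> Xb i = id \<and> Zb i \<circ> Zb i = id \<and> anticommute (Xb i) (Zb i)) \<and>
     (\<forall>i\<in>J. \<forall>j\<in>J. commute (Xb i) (Xb j) \<and> commute (Zb i) (Zb j) \<and>
        (i \<noteq> j \<longrightarrow> commute (Xb i) (Zb j))) \<and>
     logical_operators Q S = generate (pauli_group Q) (S \<union> {phase 1} \<union> Xb ` J \<union> Zb ` J)"

text \<open>
  Minimum distance of a subsystem code, \<open>Ls\<close> being the set of logical Pauli operators of the
  logical (non-gauge) qubits.
\<close>

definition minimum_distance :: "'q set \<Rightarrow> 'q operator set \<Rightarrow> 'q operator set \<Rightarrow> nat" where
  "minimum_distance Q S Ls =
     Inf {weight E | E. pauli_support E \<subseteq> Q \<and> (\<forall>A\<in>S. commute (pauli_string E) A) \<and>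
       (\<exists>A\<in>Ls. anticommute (pauli_string E) A)}"


section \<open>The subsystem surface code with open boundaries\<close>

text \<open>
  \<open>Vert x y\<close> is the qubit at the vertex \<open>(x, y)\<close>, \<open>HEdge x y\<close> the one on the edge from \<open>(x, y)\<close> to
  \<open>(x + 1, y)\<close>, and \<open>VEdge x y\<close> the one on the edge from \<open>(x, y)\<close> to \<open>(x, y + 1)\<close>. A plaquette is
  given by its south-west corner.
\<close>

datatype qubit = Vert nat nat | HEdge nat nat | VEdge nat nat

definition qubits :: "nat \<Rightarrow> qubit set" where
  "qubits L = {Vert x y | x y. x \<le> L \<and> y \<le> L} \<union> {HEdge x y | x y. x < L \<and> y \<le> L}
     \<union> {VEdge x y | x y. x \<le> L \<and> y < L}"

definition plaquettes :: "nat \<Rightarrow> (nat \<times> nat) set" where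
  "plaquettes L = {..<L} \<times> {..<L}"

datatype corner = SW | SE | NW | NE

fun triangle :: "corner \<Rightarrow> nat \<times> nat \<Rightarrow> qubit set" where
  "triangle SW (x, y) = {Vert x y, HEdge x y, VEdge x y}"
| "triangle SE (x, y) = {Vert (x + 1) y, HEdge x y, VEdge (x + 1) y}"
| "triangle NW (x, y) = {Vert x (y + 1), HEdge x (y + 1), VEdge x y}"
| "triangle NE (x, y) = {Vert (x + 1) (y + 1), HEdge x (y + 1), VEdge (x + 1) y}"

fun triangle_op :: "corner \<Rightarrow> nat \<times> nat \<Rightarrow> qubit operator" where
  "triangle_op SW p = X_on (triangle SW p)"
| "triangle_op NE p = X_on (triangle NE p)"
| "triangle_op SE p = Z_on (triangle SE p)"
| "triangle_op NW p = Z_on (triangle NW p)"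

definition plaquette_stab_X :: "nat \<times> nat \<Rightarrow> qubit operator" where
  "plaquette_stab_X p = triangle_op SW p \<circ> triangle_op NE p"

definition plaquette_stab_Z :: "nat \<times> nat \<Rightarrow> qubit operator" where
  "plaquette_stab_Z p = triangle_op SE p \<circ> triangle_op NW p"

text \<open>In order: the left, right, top and bottom boundary.\<close>

definition boundary_stabs :: "nat \<Rightarrow> qubit operator set" where
  "boundary_stabs L =
     {X_on {VEdge 0 y, Vert 0 (y + 1)} | y. y < L} \<union>
     {X_on {VEdge L y, Vert L y} | y. y < L} \<union>
     {Z_on {HEdge x L, Vert (x + 1) L} | x. x < L} \<union>
     {Z_on {HEdge x 0, Vert x 0} | x. x < L}"

definition stab_generators :: "nat \<Rightarrow> qubit operator set" where
  "stab_generators L =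
     plaquette_stab_X ` plaquettes L \<union> plaquette_stab_Z ` plaquettes L \<union> boundary_stabs L"

definition stab_group :: "nat \<Rightarrow> qubit operator set" where
  "stab_group L = generate (pauli_group (qubits L)) (stab_generators L)"

definition horizontal_line :: "nat \<Rightarrow> nat \<Rightarrow> qubit set" where
  "horizontal_line L y = {Vert x y | x. x \<le> L} \<union> {HEdge x y | x. x < L}"

definition vertical_line :: "nat \<Rightarrow> nat \<Rightarrow> qubit set" where
  "vertical_line L x = {Vert x y | y. y \<le> L} \<union> {VEdge x y | y. y < L}"

text \<open>
  On this lattice the minimum distance is \<open>L + 1\<close>, not the value \<open>L\<close> found in the literature:
  the \<open>L + 1\<close> disjoint vertical lines of \<open>Z\<close> operators differ by elements of the stabilizer group
  (the product of the Z-stabilizers of a column of plaquettes and of the boundary operators at its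
  two ends is the product of the two adjacent lines), so an error that commutes with the stabilizer
  group and anti-commutes with one of them acts on every one of them; likewise for horizontal lines
  of \<open>X\<close> operators. For \<open>L \<ge> 1\<close>, weight
  \<open>L + 1\<close> is attained by the bottom line of \<open>X\<close> operators multiplied by the SW triangle operators
  of the bottom row of plaquettes.
\<close>

text \<open>The encoded qubits: \<open>Some p\<close> is the gauge qubit of plaquette \<open>p\<close>, \<open>None\<close> the logical qubit.\<close>

definition gauge_qubits :: "nat \<Rightarrow> (nat \<times> nat) option set" where
  "gauge_qubits L = Some ` plaquettes L"

definition logical_qubits :: "(nat \<times> nat) option set" where
  "logical_qubits = {None}"

definition encoded_X :: "qubit set \<Rightarrow> (nat \<times> nat) option \<Rightarrow> qubit operator" where
  "encoded_X \<Gamma> i = (case i of Some p \<Rightarrow> triangle_op SW p | None \<Rightarrow> X_on \<Gamma>)"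

definition encoded_Z :: "qubit set \<Rightarrow> (nat \<times> nat) option \<Rightarrow> qubit operator" where
  "encoded_Z \<Lambda> i = (case i of Some p \<Rightarrow> triangle_op SE p | None \<Rightarrow> Z_on \<Lambda>)"

end

theory Submission
  imports Defs
begin

text \<open>
  Up to a phase, a Pauli operator is a pair of sets of qubits (its \<open>X\<close> and its \<open>Z\<close> part), and two
  of them commute iff the mutual overlaps have equal parity, so everything becomes linear algebra
  over the two-element field. The stabilizers are purely of type \<open>X\<close> or of type \<open>Z\<close>. Once they are
  independent, orthogonal to each other and to the proposed logical operators, and the latter are
  paired as Pauli operators should be, comparing the number of qubits with the number of generators
  and encoded qubits shows that nothing is missing: a subspace and its orthogonal complement have
  cardinalities multiplying to \<open>2 ^ n\<close>. On the lattice, adjacent parallel lines differ by a product of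
  stabilizers; hence an error that commutes with the stabilizers and anti-commutes with one line meets
  all \<open>L + 1\<close> parallel ones.
\<close>

section \<open>Sets as vectors over the two-element field\<close>

text \<open>Signs are the obstacle behind the linear algebra: \<open>- id\<close> must stay outside
  the stabilizer group, so phases cannot simply be dropped. Every Pauli operator is therefore put
  into the normal form \<open>pauli_op k a b\<close>: X on \<open>a\<close> acts first, then Z on
  \<open>b\<close>, then the factor i^k. Multiplying normal forms creates a sign only from the
  overlap of an X part with a Z part. Within the stabilizer group all these overlaps are even, so
  the group consists of elements with \<open>k = 0\<close>. Gauge qubits and the logical qubit are
  treated alike, as one index set of encoded qubits; this makes the count exact: 3L^2 + 4L + 1 =
  L(L+2) + L(L+2) + (L^2+1), for X checks, Z checks and encoded qubits. Exchanging X and Z is a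
  symmetry of the abstract setting, so most facts are proved for one type only. The dimension of the
  code space comes from an explicit basis with one vector for each subset of the encoded
  qubits.\<close>

definition sdiff :: "'a set \<Rightarrow> 'a set \<Rightarrow> 'a set" (infixl "\<triangle>" 65) where
  "A \<triangle> B = {j. (j \<in> A) \<noteq> (j \<in> B)}"

text \<open>The standard bilinear form over the two-element field; orthogonality is its
  negation.\<close>

definition odd_overlap :: "'a set \<Rightarrow> 'a set \<Rightarrow> bool" where
  "odd_overlap A B \<longleftrightarrow> odd (card (A \<inter> B))"

text \<open>A linear combination over the two-element field: \<open>K\<close> plays the role of the
  coefficient vector, and a point survives iff it is hit an odd number of times. Independence of the
  family thus becomes triviality of a kernel.\<close>

definition xsum :: "('i \<Rightarrow> 'a set) \<Rightarrow> 'i set \<Rightarrow> 'a set" where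
  "xsum f K = {j. odd (card {i \<in> K. j \<in> f i})}"

lemma mem_sdiff [simp]: "j \<in> A \<triangle> B \<longleftrightarrow> (j \<in> A) \<noteq> (j \<in> B)"
  by (simp add: sdiff_def)

lemma sdiff_self [simp]: "A \<triangle> A = {}"
  and sdiff_empty [simp]: "A \<triangle> {} = A" "{} \<triangle> A = A"
  by (auto simp: sdiff_def)

lemma sdiff_assoc: "(A \<triangle> B) \<triangle> C = A \<triangle> (B \<triangle> C)"
  and sdiff_commute: "A \<triangle> B = B \<triangle> A"
  and sdiff_cancel [simp]: "A \<triangle> (A \<triangle> B) = B"
  by auto

lemma sdiff_subset: "A \<subseteq> C \<Longrightarrow> B \<subseteq> C \<Longrightarrow> A \<triangle> B \<subseteq> C"
  by auto

lemma sdiff_eq_empty_iff: "A \<triangle> B = {} \<longleftrightarrow> A = B"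
  by auto

lemma finite_sdiff [simp, intro]: "finite A \<Longrightarrow> finite B \<Longrightarrow> finite (A \<triangle> B)"
  by (rule finite_subset[of _ "A \<union> B"]) auto

text \<open>The intersection is counted twice in \<open>card A + card B\<close> and so drops out
  modulo 2. All bilinearity below rests on this.\<close>

lemma odd_card_sdiff:
  assumes "finite A" "finite B"
  shows "odd (card (A \<triangle> B)) \<longleftrightarrow> odd (card A) \<noteq> odd (card B)"
proof -
  have "card (A \<triangle> B) = card (A - B) + card (B - A)"
    using assms by (subst card_Un_disjoint[symmetric]) (auto intro!: arg_cong[of _ _ card])
  moreover have "card A = card (A - B) + card (A \<inter> B)" "card B = card (B - A) + card (A \<inter> B)"
    using assms by (subst card_Un_disjoint[symmetric]; auto intro!: arg_cong[of _ _ card])+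
  ultimately show ?thesis by simp blast
qed

lemma odd_overlap_commute: "odd_overlap A B = odd_overlap B A"
  by (simp add: odd_overlap_def Int_commute)

lemma odd_overlap_empty [simp]: "\<not> odd_overlap {} A" "\<not> odd_overlap A {}"
  by (simp_all add: odd_overlap_def)

lemma odd_overlap_sdiff:
  assumes "finite A" "finite B"
  shows "odd_overlap (A \<triangle> B) C \<longleftrightarrow> odd_overlap A C \<noteq> odd_overlap B C"
proof -
  have "(A \<triangle> B) \<inter> C = (A \<inter> C) \<triangle> (B \<inter> C)" by auto
  then show ?thesis using assms odd_card_sdiff[of "A \<inter> C" "B \<inter> C"]
    by (simp add: odd_overlap_def)
qed

lemma odd_overlap_sdiff_right:
  assumes "finite A" "finite B"
  shows "odd_overlap C (A \<triangle> B) \<longleftrightarrow> odd_overlap C A \<noteq> odd_overlap C B"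
  using odd_overlap_sdiff[OF assms] by (simp add: odd_overlap_commute)

lemma odd_overlap_insert:
  assumes "finite A" "j \<notin> A"
  shows "odd_overlap (insert j A) B \<longleftrightarrow> (j \<in> B) \<noteq> odd_overlap A B"
  using assms by (auto simp: odd_overlap_def Int_insert_left)

lemma xsum_empty [simp]: "xsum f {} = {}"
  by (simp add: xsum_def)

lemma xsum_sdiff:
  assumes "finite K" "finite M"
  shows "xsum f (K \<triangle> M) = xsum f K \<triangle> xsum f M"
proof -
  have "{i \<in> K \<triangle> M. j \<in> f i} = {i \<in> K. j \<in> f i} \<triangle> {i \<in> M. j \<in> f i}" for j by auto
  then show ?thesis using assms by (auto simp: xsum_def odd_card_sdiff)
qed

lemma xsum_singleton [simp]: "xsum f {i} = f i"
proof -
  have "{k \<in> {i}. j \<in> f k} = (if j \<in> f i then {i} else {})" for j by auto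
  then show ?thesis by (auto simp: xsum_def)
qed

lemma xsum_insert:
  assumes "finite K" "i \<notin> K"
  shows "xsum f (insert i K) = f i \<triangle> xsum f K"
proof -
  have "insert i K = {i} \<triangle> K" using assms by auto
  then show ?thesis using assms by (simp add: xsum_sdiff)
qed

lemma xsum_subset:
  assumes "\<And>i. i \<in> K \<Longrightarrow> f i \<subseteq> Q"
  shows "xsum f K \<subseteq> Q"
proof
  fix j assume "j \<in> xsum f K"
  then have "{i \<in> K. j \<in> f i} \<noteq> {}" by (auto simp: xsum_def simp del: Collect_empty_eq)
  with assms show "j \<in> Q" by blast
qed

lemma odd_overlap_xsum:
  assumes "finite K" "\<And>i. i \<in> K \<Longrightarrow> finite (f i)"
  shows "odd_overlap (xsum f K) B \<longleftrightarrow> odd (card {i \<in> K. odd_overlap (f i) B})"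
  using assms
proof (induction K rule: finite_induct)
  case (insert i K)
  have fin: "finite (xsum f K)"
    using insert by (intro finite_subset[OF xsum_subset[of K f "\<Union>(f ` K)"]]) auto
  have "{k \<in> insert i K. odd_overlap (f k) B} =
      (if odd_overlap (f i) B then {i} else {}) \<triangle> {k \<in> K. odd_overlap (f k) B}"
    using insert by auto
  then show ?case using insert fin by (simp add: xsum_insert odd_overlap_sdiff odd_card_sdiff)
qed simp

text \<open>Pairing with a vector dual to index \<open>j\<close> reads off the coefficient of
  \<open>j\<close>. This is how logical components are extracted later.\<close>

lemma odd_overlap_xsum_dual:
  assumes "finite K" "\<And>i. i \<in> K \<Longrightarrow> finite (f i)"
    and "\<And>i. i \<in> K \<Longrightarrow> odd_overlap (f i) B \<longleftrightarrow> i = j"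
  shows "odd_overlap (xsum f K) B \<longleftrightarrow> j \<in> K"
proof -
  have one: "{i \<in> K. odd_overlap (f i) B} = (if j \<in> K then {j} else {})" using assms(3) by auto
  show ?thesis using assms(1,2) by (simp add: odd_overlap_xsum one)
qed

lemma not_odd_overlap_xsum:
  assumes "finite K" "\<And>i. i \<in> K \<Longrightarrow> finite (f i)"
    and "\<And>i. i \<in> K \<Longrightarrow> \<not> odd_overlap (f i) B"
  shows "\<not> odd_overlap (xsum f K) B"
proof -
  have none: "{i \<in> K. odd_overlap (f i) B} = {}" using assms(3) by auto
  show ?thesis using assms(1,2) by (simp add: odd_overlap_xsum none)
qed

section \<open>Cardinality of orthogonal complements over the two-element field\<close>

lemma sum_sign_cancel:
  fixes g :: "'a \<Rightarrow> int"
  assumes "bij_betw h A A" "\<And>x. x \<in> A \<Longrightarrow> g (h x) = - g x"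
  shows "sum g A = 0"
proof -
  have "sum g A = (\<Sum>x\<in>A. g (h x))" using assms(1) by (simp add: sum.reindex_bij_betw)
  also have "\<dots> = - sum g A" using assms(2) by (simp add: sum_negf)
  finally show ?thesis by simp
qed

text \<open>Double counting of the character sum of \<open>(- 1) ^ card (v \<inter> w)\<close> over \<open>V \<times> Pow Q\<close>.\<close>

lemma card_mult_card_orthogonal:
  assumes Q: "finite Q" and V: "V \<subseteq> Pow Q" "{} \<in> V"
    and closed: "\<And>v w. v \<in> V \<Longrightarrow> w \<in> V \<Longrightarrow> v \<triangle> w \<in> V"
  shows "card V * card {w. w \<subseteq> Q \<and> (\<forall>v\<in>V. \<not> odd_overlap v w)} = 2 ^ card Q"
proof -
  define \<chi> :: "'a set \<Rightarrow> 'a set \<Rightarrow> int" where "\<chi> v w = (if odd_overlap v w then - 1 else 1)" for v w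
  define P where "P = {w. w \<subseteq> Q \<and> (\<forall>v\<in>V. \<not> odd_overlap v w)}"
  have fin: "finite v" if "v \<in> V" for v using that V Q by (meson PowD finite_subset subsetD)
  have finV: "finite V" using V Q by (meson finite_Pow_iff finite_subset)
  \<comment> \<open>Translation by \<open>u\<close> is its own inverse, hence a bijection of any set
    that it maps into itself.\<close>
  have bij: "bij_betw (\<lambda>w. u \<triangle> w) A A" if "\<And>w. w \<in> A \<Longrightarrow> u \<triangle> w \<in> A" for u :: "'a set" and A
    by (rule bij_betw_byWitness[where f' = "\<lambda>w. u \<triangle> w"]) (use that in auto)
  have 1: "(\<Sum>w\<in>Pow Q. \<chi> v w) = (if v = {} then 2 ^ card Q else 0)" if v: "v \<in> V" for v
  proof (cases "v = {}")
    case False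
    then obtain j where j: "j \<in> v" by auto
    have "j \<in> Q" using j v V by auto
    \<comment> \<open>Toggling one point \<open>j\<close> of \<open>v\<close> in \<open>w\<close>
      flips the parity of the overlap, so the character of a nonempty \<open>v\<close> sums to
      zero.\<close>
    have "\<chi> v ({j} \<triangle> w) = - \<chi> v w" if "w \<in> Pow Q" for w
      using that j finite_subset[OF _ Q, of w]
      by (auto simp: \<chi>_def odd_overlap_sdiff_right odd_overlap_insert odd_overlap_commute[of v "{j}"])
    then have "(\<Sum>w\<in>Pow Q. \<chi> v w) = 0"
      by (intro sum_sign_cancel[OF bij[of "Pow Q" "{j}"]]) (use \<open>j \<in> Q\<close> in auto)
    then show ?thesis using False by simp
  qed (use Q in \<open>simp add: \<chi>_def card_Pow\<close>)
  have 2: "(\<Sum>v\<in>V. \<chi> v w) = (if w \<in> P then int (card V) else 0)" if w: "w \<in> Pow Q" for w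
  proof (cases "w \<in> P")
    case True
    then have "\<chi> v w = 1" if "v \<in> V" for v using that by (simp add: \<chi>_def P_def)
    then show ?thesis using True by simp
  next
    case False
    then obtain u where u: "u \<in> V" "odd_overlap u w" using w by (auto simp: P_def)
    \<comment> \<open>A single \<open>u\<close> in \<open>V\<close> with odd overlap makes
      translation by \<open>u\<close> pair off the summands with opposite signs.\<close>
    have "\<chi> (u \<triangle> v) w = - \<chi> v w" if "v \<in> V" for v
      using that u fin by (auto simp: \<chi>_def odd_overlap_sdiff)
    then have "(\<Sum>v\<in>V. \<chi> v w) = 0"
      by (intro sum_sign_cancel[OF bij[of V u]]) (use closed u in auto)
    then show ?thesis using False by simp
  qed
  \<comment> \<open>In one order of summation only \<open>v = {}\<close> contributes, in the other
    only the \<open>w\<close> orthogonal to \<open>V\<close>.\<close>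
  have "int (2 ^ card Q) = (\<Sum>v\<in>V. \<Sum>w\<in>Pow Q. \<chi> v w)"
    using 1 finV V(2) by (simp add: sum.delta cong: sum.cong)
  also have "\<dots> = (\<Sum>w\<in>Pow Q. \<Sum>v\<in>V. \<chi> v w)" by (rule sum.swap)
  also have "\<dots> = (\<Sum>w\<in>Pow Q. if w \<in> P then int (card V) else 0)" using 2 by simp
  also have "\<dots> = (\<Sum>w\<in>P. int (card V))"
    using Q by (intro sum.mono_neutral_cong_right) (auto simp: P_def)
  finally have "int (2 ^ card Q) = int (card V * card P)" by simp
  then show ?thesis unfolding P_def of_nat_eq_iff by (rule sym)
qed


section \<open>Pauli operators\<close>

text \<open>The normal form i^k Z(b) X(a): X on \<open>a\<close> flips the bits in \<open>a\<close>,
  and Z on \<open>b\<close> contributes one sign for each bit of \<open>b\<close> that is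
  set.\<close>

definition pauli_op :: "nat \<Rightarrow> 'q set \<Rightarrow> 'q set \<Rightarrow> 'q operator" where
  "pauli_op k a b \<psi> = (\<lambda>c. \<i> ^ k * (- 1) ^ card {j \<in> b. c j} * \<psi> (\<lambda>j. c j \<noteq> (j \<in> a)))"

text \<open>Restoring the normal form moves X on \<open>a\<close> past Z on \<open>b'\<close>, at
  the cost of one sign per common qubit; hence the summand \<open>2 * card (a \<inter> b')\<close>
  in the exponent of the imaginary unit.\<close>

lemma pauli_op_comp:
  assumes "finite b" "finite b'"
  shows "pauli_op k a b \<circ> pauli_op k' a' b' =
    pauli_op (k + k' + 2 * card (a \<inter> b')) (a \<triangle> a') (b \<triangle> b')"
proof (intro ext)
  fix \<psi> c
  have "{j \<in> b'. c j \<noteq> (j \<in> a)} = {j \<in> b'. c j} \<triangle> (a \<inter> b')"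
    "{j \<in> b \<triangle> b'. c j} = {j \<in> b. c j} \<triangle> {j \<in> b'. c j}" by auto
  then have "odd (card {j \<in> b'. c j \<noteq> (j \<in> a)}) \<longleftrightarrow> odd (card {j \<in> b'. c j}) \<noteq> odd (card (a \<inter> b'))"
    "odd (card {j \<in> b \<triangle> b'. c j}) \<longleftrightarrow> odd (card {j \<in> b. c j}) \<noteq> odd (card {j \<in> b'. c j})"
    using assms by (simp_all add: odd_card_sdiff)
  then have sgn: "(- 1) ^ card {j \<in> b. c j} * (- 1) ^ card {j \<in> b'. c j \<noteq> (j \<in> a)} =
      \<i> ^ (2 * card (a \<inter> b')) * (- 1 :: complex) ^ card {j \<in> b \<triangle> b'. c j}"
    by (auto simp: power_mult minus_one_power_iff)
  have arg: "(\<lambda>j. (c j \<noteq> (j \<in> a)) \<noteq> (j \<in> a')) = (\<lambda>j. c j \<noteq> (j \<in> a \<triangle> a'))" by auto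
  have "(pauli_op k a b \<circ> pauli_op k' a' b') \<psi> c = \<i> ^ k * \<i> ^ k' *
      ((- 1) ^ card {j \<in> b. c j} * (- 1) ^ card {j \<in> b'. c j \<noteq> (j \<in> a)}) * \<psi> (\<lambda>j. c j \<noteq> (j \<in> a \<triangle> a'))"
    unfolding pauli_op_def comp_apply arg by (simp only: mult.assoc mult.left_commute)
  also have "\<dots> = pauli_op (k + k' + 2 * card (a \<inter> b')) (a \<triangle> a') (b \<triangle> b') \<psi> c"
    unfolding pauli_op_def sgn by (simp add: power_add)
  finally show "(pauli_op k a b \<circ> pauli_op k' a' b') \<psi> c =
      pauli_op (k + k' + 2 * card (a \<inter> b')) (a \<triangle> a') (b \<triangle> b') \<psi> c" .
qed

lemma pauli_op_cong: "\<i> ^ k = \<i> ^ k' \<Longrightarrow> pauli_op k a b = pauli_op k' a b"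
  by (simp add: pauli_op_def fun_eq_iff)

lemma pauli_op_id: "pauli_op 0 {} {} = id"
  by (simp add: pauli_op_def fun_eq_iff)

lemma uminus_pauli_op: "- pauli_op k a b = pauli_op (k + 2) a b"
  by (auto simp: pauli_op_def fun_eq_iff)

lemma pauli_op_eq_iff:
  assumes "finite b" "finite b'"
  shows "pauli_op k a b = pauli_op k' a' b' \<longleftrightarrow> \<i> ^ k = \<i> ^ k' \<and> a = a' \<and> b = b'"
proof
  assume eq: "pauli_op k a b = pauli_op k' a' b'"
  \<comment> \<open>The image of the all-zero basis state is concentrated on the indicator of
    \<open>a\<close>, so it determines \<open>a\<close>.\<close>
  have "pauli_op k a b (\<lambda>c. of_bool (c = (\<lambda>j. False))) (\<lambda>j. j \<in> a) \<noteq> 0"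
    by (simp add: pauli_op_def)
  then have "pauli_op k' a' b' (\<lambda>c. of_bool (c = (\<lambda>j. False))) (\<lambda>j. j \<in> a) \<noteq> 0"
    by (simp add: eq)
  then have a: "a = a'" by (auto simp: pauli_op_def fun_eq_iff of_bool_def split: if_splits)
  \<comment> \<open>The constant state is unaffected by bit flips, so only phase and signs remain.
    The all-zero argument then isolates the phase, and an argument with a single bit
    \<open>j\<close> set tells whether \<open>j\<close> lies in \<open>b\<close>.\<close>
  have 1: "\<i> ^ k * (- 1) ^ card {j \<in> b. c j} = \<i> ^ k' * (- 1) ^ card {j \<in> b'. c j}" for c
    using fun_cong[OF fun_cong[OF eq, of "\<lambda>c. 1"], of c] by (simp add: pauli_op_def)
  from 1[of "\<lambda>j. False"] have k: "\<i> ^ k = \<i> ^ k'" by simp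
  have "{l \<in> A. l = j} = (if j \<in> A then {j} else {})" for j :: 'a and A by auto
  then have "j \<in> b \<longleftrightarrow> j \<in> b'" for j using 1[of "\<lambda>l. l = j"] k by (auto split: if_splits)
  with a k show "\<i> ^ k = \<i> ^ k' \<and> a = a' \<and> b = b'" by blast
qed (simp add: pauli_op_def fun_eq_iff)

lemma i_power_add_two_card:
  "\<i> ^ (k + 2 * n) = (if odd n then - (\<i> ^ k) else \<i> ^ k)"
  by (simp add: power_add power_mult minus_one_power_iff)

text \<open>The two products have the same supports and differ at most in sign, which is governed by
  the symplectic form of the pairs \<open>(a, b)\<close> and \<open>(a', b')\<close>.\<close>

lemma commute_pauli_op:
  assumes "finite b" "finite b'"
  shows "commute (pauli_op k a b) (pauli_op k' a' b') \<longleftrightarrow> (odd_overlap a b' \<longleftrightarrow> odd_overlap a' b)"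
  using assms
  by (auto simp: commute_def pauli_op_comp pauli_op_eq_iff i_power_add_two_card odd_overlap_def
      sdiff_commute add.commute[of k])

lemma anticommute_pauli_op:
  assumes "finite b" "finite b'"
  shows "anticommute (pauli_op k a b) (pauli_op k' a' b') \<longleftrightarrow> (odd_overlap a b' \<noteq> odd_overlap a' b)"
  using assms
  by (auto simp: anticommute_def pauli_op_comp pauli_op_eq_iff uminus_pauli_op
      i_power_add_two_card odd_overlap_def sdiff_commute add.commute[of k])

section \<open>Pauli strings and the Pauli group in normal form\<close>

definition x_part :: "('q \<Rightarrow> pauli) \<Rightarrow> 'q set" where
  "x_part E = {j. E j = PX \<or> E j = PY}"

definition z_part :: "('q \<Rightarrow> pauli) \<Rightarrow> 'q set" where
  "z_part E = {j. E j = PZ \<or> E j = PY}"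

text \<open>The constant 3 comes from Y = i^3 Z X: a \<open>PY\<close> belongs to both parts and
  contributes this phase.\<close>

lemma pauli_at_eq_pauli_op:
  "pauli_at (E j) j = pauli_op (3 * card ({j} \<inter> {j. E j = PY})) ({j} \<inter> x_part E) ({j} \<inter> z_part E)"
proof (intro ext)
  fix \<psi> c
  have flip: "(\<lambda>i. c i = (i \<noteq> j)) = c(j := \<not> c j)" by auto
  have set: "{i. i = j \<and> c i} = (if c j then {j} else {})" by auto
  have triv: "c(j := True) = c" if "c j" using that by (simp add: fun_upd_idem)
  have triv': "c(j := False) = c" if "\<not> c j" using that by (simp add: fun_upd_idem)
  show "pauli_at (E j) j \<psi> c =
      pauli_op (3 * card ({j} \<inter> {j. E j = PY})) ({j} \<inter> x_part E) ({j} \<inter> z_part E) \<psi> c"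
    by (cases "E j"; cases "c j")
      (simp_all add: pauli_at_def pauli_op_def x_part_def z_part_def UNIV_bool flip set triv triv'
        Int_insert_left power3_eq_cube)
qed

lemma pauli_string_eq_pauli_op:
  assumes "finite (pauli_support E)"
  shows "pauli_string E = pauli_op (3 * card {j. E j = PY}) (x_part E) (z_part E)"
proof -
  let ?f = "\<lambda>j A. pauli_at (E j) j \<circ> A"
  have comm: "pauli_at (E i) i \<circ> pauli_at (E j) j = pauli_at (E j) j \<circ> pauli_at (E i) i" for i j
  proof (cases "i = j")
    case False
    then have "{i} \<inter> A \<inter> ({j} \<inter> B) = {}" "{j} \<inter> A \<inter> ({i} \<inter> B) = {}" for A B by auto
    then show ?thesis unfolding pauli_at_eq_pauli_op
      by (simp add: commute_pauli_op commute_def[symmetric] odd_overlap_def)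
  qed simp
  interpret comp_fun_commute ?f
    by standard (simp add: fun_eq_iff comp_assoc, metis comm comp_apply)
  \<comment> \<open>The induction runs over arbitrary finite \<open>F\<close> with \<open>E\<close>
    fixed, cutting its parts down to \<open>F\<close>. A new factor lives on a fresh qubit, so no
    sign arises.\<close>
  have "Finite_Set.fold ?f id F =
      pauli_op (3 * card (F \<inter> {j. E j = PY})) (F \<inter> x_part E) (F \<inter> z_part E)" if "finite F" for F
    using that
  proof (induction F rule: finite_induct)
    case (insert j F)
    have "({j} \<inter> x_part E) \<triangle> (F \<inter> x_part E) = insert j F \<inter> x_part E"
      "({j} \<inter> z_part E) \<triangle> (F \<inter> z_part E) = insert j F \<inter> z_part E"
      "{j} \<inter> x_part E \<inter> (F \<inter> z_part E) = {}"
      "card (insert j F \<inter> {j. E j = PY}) = card ({j} \<inter> {j. E j = PY}) + card (F \<inter> {j. E j = PY})"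
      using insert by (auto simp: card_insert_if Int_insert_left)
    moreover have "Finite_Set.fold ?f id (insert j F) = pauli_at (E j) j \<circ> Finite_Set.fold ?f id F"
      using insert by (rule_tac fold_insert)
    moreover have "pauli_at (E j) j \<circ>
        pauli_op (3 * card (F \<inter> {j. E j = PY})) (F \<inter> x_part E) (F \<inter> z_part E) =
      pauli_op (3 * card (insert j F \<inter> {j. E j = PY})) (insert j F \<inter> x_part E) (insert j F \<inter> z_part E)"
      unfolding pauli_at_eq_pauli_op using calculation insert.hyps by (simp add: pauli_op_comp)
    ultimately show ?case by (simp only: insert.IH)
  qed (simp add: pauli_op_id)
  from this[OF assms] have "pauli_string E = pauli_op (3 * card (pauli_support E \<inter> {j. E j = PY}))
      (pauli_support E \<inter> x_part E) (pauli_support E \<inter> z_part E)"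
    unfolding pauli_string_def .
  moreover have "pauli_support E \<inter> {j. E j = PY} = {j. E j = PY}"
    "pauli_support E \<inter> x_part E = x_part E" "pauli_support E \<inter> z_part E = z_part E"
    by (auto simp: pauli_support_def x_part_def z_part_def)
  ultimately show ?thesis by simp
qed

lemma X_on_eq_pauli_op:
  assumes "finite A"
  shows "X_on A = pauli_op 0 A {}"
proof -
  let ?E = "\<lambda>j. if j \<in> A then PX else PI"
  have "pauli_support ?E = A" "{j. ?E j = PY} = {}" "x_part ?E = A" "z_part ?E = {}"
    by (auto simp: pauli_support_def x_part_def z_part_def)
  then show ?thesis unfolding X_on_def using assms pauli_string_eq_pauli_op[of ?E] by (simp only: card.empty mult_0_right)
qed

lemma Z_on_eq_pauli_op:
  assumes "finite A"
  shows "Z_on A = pauli_op 0 {} A"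
proof -
  let ?E = "\<lambda>j. if j \<in> A then PZ else PI"
  have "pauli_support ?E = A" "{j. ?E j = PY} = {}" "x_part ?E = {}" "z_part ?E = A"
    by (auto simp: pauli_support_def x_part_def z_part_def)
  then show ?thesis unfolding Z_on_def using assms pauli_string_eq_pauli_op[of ?E] by (simp only: card.empty mult_0_right)
qed

lemma phase_comp_pauli_op: "phase l \<circ> pauli_op k a b = pauli_op (l + k) a b"
  by (simp add: phase_def pauli_op_def fun_eq_iff power_add mult.assoc)

lemma carrier_pauli_group:
  assumes "finite Q"
  shows "carrier (pauli_group Q) = {pauli_op k a b | k a b. a \<subseteq> Q \<and> b \<subseteq> Q}"
proof (intro equalityI subsetI)
  fix A assume "A \<in> carrier (pauli_group Q)"
  then obtain k E where E: "A = phase k \<circ> pauli_string E" "pauli_support E \<subseteq> Q"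
    by (auto simp: pauli_group_def)
  have "finite (pauli_support E)" using E(2) assms by (rule finite_subset)
  moreover have "x_part E \<subseteq> Q" "z_part E \<subseteq> Q"
    using E(2) by (auto simp: x_part_def z_part_def pauli_support_def)
  ultimately show "A \<in> {pauli_op k a b | k a b. a \<subseteq> Q \<and> b \<subseteq> Q}"
    using E(1) by (auto simp: pauli_string_eq_pauli_op phase_comp_pauli_op)
next
  fix A assume "A \<in> {pauli_op k a b | k a b. a \<subseteq> Q \<and> b \<subseteq> Q}"
  then obtain k a b where A: "A = pauli_op k a b" "a \<subseteq> Q" "b \<subseteq> Q" by auto
  define E where "E j = (if j \<in> a then if j \<in> b then PY else PX else if j \<in> b then PZ else PI)" for j
  have E: "pauli_support E \<subseteq> Q" "{j. E j = PY} = a \<inter> b" "x_part E = a" "z_part E = b"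
    using A by (auto simp: E_def x_part_def z_part_def pauli_support_def split: if_splits)
  then have "pauli_string E = pauli_op (3 * card (a \<inter> b)) a b"
    using finite_subset[OF E(1) assms] by (simp add: pauli_string_eq_pauli_op)
  \<comment> \<open>The string already carries the exponent \<open>3 * card (a \<inter> b)\<close>;
    one further \<open>card (a \<inter> b)\<close> completes it to a multiple of 4.\<close>
  then have "A = phase (k + card (a \<inter> b)) \<circ> pauli_string E"
    by (auto simp: A(1) phase_comp_pauli_op power_add power_mult power3_eq_cube
        simp flip: power_mult_distrib intro!: pauli_op_cong)
  with E(1) show "A \<in> carrier (pauli_group Q)" by (auto simp: pauli_group_def)
qed

lemma mult_pauli_group [simp]: "mult (pauli_group Q) = (\<circ>)"
  and one_pauli_group [simp]: "one (pauli_group Q) = id"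
  by (simp_all add: pauli_group_def)

text \<open>The exponent \<open>3 * k\<close> is \<open>- k\<close> modulo 4, and
  \<open>2 * card (a \<inter> b)\<close> undoes the sign created by the composition.\<close>

lemma pauli_op_inverse:
  assumes "finite b"
  shows "pauli_op (3 * k + 2 * card (a \<inter> b)) a b \<circ> pauli_op k a b = id"
proof -
  have "\<i> ^ (3 * k + 2 * card (a \<inter> b) + k + 2 * card (a \<inter> b)) = (\<i> ^ 4) ^ (k + card (a \<inter> b))"
    by (simp only: power_mult[symmetric]) (simp add: algebra_simps)
  also have "\<dots> = \<i> ^ 0" by simp
  finally have "pauli_op (3 * k + 2 * card (a \<inter> b) + k + 2 * card (a \<inter> b)) {} {} = id"
    unfolding pauli_op_id[symmetric] by (rule pauli_op_cong)
  then show ?thesis using assms by (simp add: pauli_op_comp)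
qed

lemma group_pauli_group:
  assumes "finite Q"
  shows "group (pauli_group Q)"
proof (rule groupI)
  have fin: "finite b" if "b \<subseteq> Q" for b using that assms by (rule finite_subset)
  show "x \<otimes>\<^bsub>pauli_group Q\<^esub> y \<in> carrier (pauli_group Q)"
    if "x \<in> carrier (pauli_group Q)" "y \<in> carrier (pauli_group Q)" for x y
  proof -
    from that obtain k a b k' a' b' where "x = pauli_op k a b" "y = pauli_op k' a' b'"
      and sub: "a \<subseteq> Q" "b \<subseteq> Q" "a' \<subseteq> Q" "b' \<subseteq> Q"
      unfolding carrier_pauli_group[OF assms] by auto
    then have "x \<circ> y = pauli_op (k + k' + 2 * card (a \<inter> b')) (a \<triangle> a') (b \<triangle> b')"
      by (simp add: pauli_op_comp fin)
    moreover have "a \<triangle> a' \<subseteq> Q" "b \<triangle> b' \<subseteq> Q" using sub by (auto intro!: sdiff_subset)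
    ultimately show ?thesis unfolding carrier_pauli_group[OF assms] mult_pauli_group by blast
  qed
  show "\<one>\<^bsub>pauli_group Q\<^esub> \<in> carrier (pauli_group Q)"
    unfolding carrier_pauli_group[OF assms] one_pauli_group pauli_op_id[symmetric] by blast
  show "\<exists>y\<in>carrier (pauli_group Q). y \<otimes>\<^bsub>pauli_group Q\<^esub> x = \<one>\<^bsub>pauli_group Q\<^esub>"
    if "x \<in> carrier (pauli_group Q)" for x
  proof -
    from that obtain k a b where x: "x = pauli_op k a b" and sub: "a \<subseteq> Q" "b \<subseteq> Q"
      unfolding carrier_pauli_group[OF assms] by auto
    have "pauli_op (3 * k + 2 * card (a \<inter> b)) a b \<in> carrier (pauli_group Q)"
      unfolding carrier_pauli_group[OF assms] using sub by blast
    moreover have "pauli_op (3 * k + 2 * card (a \<inter> b)) a b \<circ> x = id"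
      unfolding x using fin[OF sub(2)] by (rule pauli_op_inverse)
    ultimately show ?thesis unfolding mult_pauli_group one_pauli_group by blast
  qed
qed (auto simp: comp_assoc)


section \<open>Stabilizer codes with generators of pure type\<close>

definition xspan :: "('i \<Rightarrow> 'a set) \<Rightarrow> 'i set \<Rightarrow> 'a set set" where
  "xspan f K = {xsum f M | M. M \<subseteq> K}"

lemma xspan_empty: "{} \<in> xspan f K"
  unfolding xspan_def by (auto intro!: exI[of _ "{}"])

lemma xspan_base: "i \<in> K \<Longrightarrow> f i \<in> xspan f K"
  unfolding xspan_def by (auto intro!: exI[of _ "{i}"])

lemma xspan_sdiff:
  assumes "finite K" "a \<in> xspan f K" "b \<in> xspan f K"
  shows "a \<triangle> b \<in> xspan f K"
proof -
  obtain M N where "a = xsum f M" "M \<subseteq> K" "b = xsum f N" "N \<subseteq> K"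
    using assms by (auto simp: xspan_def)
  moreover from this have "a \<triangle> b = xsum f (M \<triangle> N)"
    using finite_subset[OF _ assms(1)] by (simp add: xsum_sdiff)
  moreover have "M \<triangle> N \<subseteq> K" using \<open>M \<subseteq> K\<close> \<open>N \<subseteq> K\<close> by (rule sdiff_subset)
  ultimately show ?thesis unfolding xspan_def by blast
qed

lemma xspan_subset:
  assumes "\<And>i. i \<in> K \<Longrightarrow> f i \<subseteq> Q" "a \<in> xspan f K"
  shows "a \<subseteq> Q"
proof -
  obtain M where "a = xsum f M" "M \<subseteq> K" using assms(2) by (auto simp: xspan_def)
  then show ?thesis using assms(1) by (auto intro!: xsum_subset)
qed

lemma not_odd_overlap_xspan:
  assumes "finite K" "\<And>i. i \<in> K \<Longrightarrow> finite (f i)" "\<And>i. i \<in> K \<Longrightarrow> \<not> odd_overlap (f i) b"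
    and "a \<in> xspan f K"
  shows "\<not> odd_overlap a b"
proof -
  obtain M where "a = xsum f M" "M \<subseteq> K" using assms(4) by (auto simp: xspan_def)
  then show ?thesis using assms(1-3) finite_subset[of M K] not_odd_overlap_xsum[of M f b] by auto
qed

text \<open>Since \<open>xsum f\<close> is additive in the index set, a trivial kernel gives
  injectivity; this turns independence into a count of the span.\<close>

lemma xsum_inj:
  assumes "finite K" "\<And>M. M \<subseteq> K \<Longrightarrow> xsum f M = {} \<Longrightarrow> M = {}"
  shows "inj_on (xsum f) (Pow K)"
proof (rule inj_onI)
  fix M N assume MN: "M \<in> Pow K" "N \<in> Pow K" "xsum f M = xsum f N"
  then have "xsum f (M \<triangle> N) = {}" using assms(1) finite_subset[of _ K] by (simp add: xsum_sdiff)
  moreover have "M \<triangle> N \<subseteq> K" using MN by (auto intro!: sdiff_subset)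
  ultimately have "M \<triangle> N = {}" by (rule_tac assms(2))
  then show "M = N" by (simp add: sdiff_eq_empty_iff)
qed

lemma card_xspan:
  assumes "finite K" "\<And>M. M \<subseteq> K \<Longrightarrow> xsum f M = {} \<Longrightarrow> M = {}"
  shows "card (xspan f K) = 2 ^ card K"
proof -
  have "xspan f K = xsum f ` Pow K" by (auto simp: xspan_def)
  then show ?thesis using card_image[OF xsum_inj[OF assms]] assms(1) by (simp add: card_Pow)
qed

text \<open>An even overlap contributes an even number of signs, so phases merely add and the Pauli
  group behaves like a vector space.\<close>

lemma pauli_op_comp_even:
  assumes "finite b" "finite b'" "\<not> odd_overlap a b'"
  shows "pauli_op k a b \<circ> pauli_op k' a' b' = pauli_op (k + k') (a \<triangle> a') (b \<triangle> b')"
  using assms by (auto simp: pauli_op_comp odd_overlap_def i_power_add_two_card intro!: pauli_op_cong)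

text \<open>Generators of a Calderbank-Shor-Steane (CSS) code: each is purely of type X or purely of
  type Z.\<close>

definition css_generators ::
    "('i \<Rightarrow> 'q set) \<Rightarrow> 'i set \<Rightarrow> ('k \<Rightarrow> 'q set) \<Rightarrow> 'k set \<Rightarrow> 'q operator set" where
  "css_generators f K g M = (\<lambda>i. pauli_op 0 (f i) {}) ` K \<union> (\<lambda>i. pauli_op 0 {} (g i)) ` M"

lemma generate_pauli_op_xsum:
  assumes "finite N" "N \<subseteq> K" "(\<lambda>i. pauli_op 0 (f i) {}) ` K \<subseteq> G"
  shows "pauli_op 0 (xsum f N) {} \<in> generate (pauli_group Q) G"
  using assms(1,2)
proof (induction N rule: finite_induct)
  case empty
  then show ?case using generate.one[of "pauli_group Q" G]
    by (simp only: xsum_empty pauli_op_id one_pauli_group)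
next
  case (insert i N)
  then have "pauli_op 0 (f i) {} \<in> generate (pauli_group Q) G"
    using assms(3) by (auto intro: generate.incl)
  then have "pauli_op 0 (f i) {} \<circ> pauli_op 0 (xsum f N) {} \<in> generate (pauli_group Q) G"
    using insert generate.eng[of _ "pauli_group Q"] by fastforce
  then show ?case using insert.hyps by (simp add: pauli_op_comp_even xsum_insert)
qed

lemma generate_pauli_op_xsum_Z:
  assumes "finite N" "N \<subseteq> K" "(\<lambda>i. pauli_op 0 {} (f i)) ` K \<subseteq> G" "\<And>i. i \<in> K \<Longrightarrow> finite (f i)"
  shows "pauli_op 0 {} (xsum f N) \<in> generate (pauli_group Q) G"
  using assms(1,2)
proof (induction N rule: finite_induct)
  case empty
  then show ?case using generate.one[of "pauli_group Q" G]
    by (simp only: xsum_empty pauli_op_id one_pauli_group)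
next
  case (insert i N)
  then have "pauli_op 0 {} (f i) \<in> generate (pauli_group Q) G"
    using assms(3) by (auto intro: generate.incl)
  then have "pauli_op 0 {} (f i) \<circ> pauli_op 0 {} (xsum f N) \<in> generate (pauli_group Q) G"
    using insert generate.eng[of _ "pauli_group Q"] by fastforce
  moreover have "finite (xsum f N)"
    by (rule finite_subset[OF xsum_subset[of N f "\<Union>(f ` N)"]]) (use insert assms(4) in auto)
  ultimately show ?case using insert assms(4) by (simp add: pauli_op_comp_even xsum_insert)
qed

text \<open>Orthogonality of the two families makes every product free of signs, so the span with
  exponent 0 is already closed. Keeping the exponent exactly 0 is what later excludes
  \<open>- id\<close> and reduces independence to that of the supports.\<close>

lemma generate_css_generators:
  assumes Q: "finite Q" and KM: "finite K" "finite M"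
    and sub: "\<And>i. i \<in> K \<Longrightarrow> f i \<subseteq> Q" "\<And>i. i \<in> M \<Longrightarrow> g i \<subseteq> Q"
    and orth: "\<And>i j. i \<in> K \<Longrightarrow> j \<in> M \<Longrightarrow> \<not> odd_overlap (f i) (g j)"
  shows "generate (pauli_group Q) (css_generators f K g M) =
      {pauli_op 0 a b | a b. a \<in> xspan f K \<and> b \<in> xspan g M}" (is "?L = ?H")
    and "subgroup {pauli_op 0 a b | a b. a \<in> xspan f K \<and> b \<in> xspan g M} (pauli_group Q)"
proof -
  have fin: "finite (f i)" if "i \<in> K" for i using sub(1)[OF that] Q by (rule finite_subset)
  have fin': "finite (g i)" if "i \<in> M" for i using sub(2)[OF that] Q by (rule finite_subset)
  have subQ: "a \<subseteq> Q" if "a \<in> xspan f K" for a using xspan_subset[OF sub(1) that] .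
  have subQ': "b \<subseteq> Q" if "b \<in> xspan g M" for b using xspan_subset[OF sub(2) that] .
  have finb: "finite b" if "b \<in> xspan g M" for b using subQ'[OF that] Q by (rule finite_subset)
  \<comment> \<open>Bilinearity is used twice: first to extend orthogonality from \<open>g\<close>
    to its span, then from \<open>f\<close> to its span.\<close>
  have even: "\<not> odd_overlap a b" if "a \<in> xspan f K" "b \<in> xspan g M" for a b
  proof (rule not_odd_overlap_xspan[OF KM(1) fin _ that(1)])
    fix i assume i: "i \<in> K"
    have "\<not> odd_overlap b (f i)"
      by (rule not_odd_overlap_xspan[OF KM(2) fin' _ that(2)])
        (use orth[OF i] in \<open>auto simp: odd_overlap_commute\<close>)
    then show "\<not> odd_overlap (f i) b" by (simp add: odd_overlap_commute)
  qed
  interpret group "pauli_group Q" using Q by (rule group_pauli_group)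
  have memH: "pauli_op 0 a b \<in> ?H" if "a \<in> xspan f K" "b \<in> xspan g M" for a b
    using that by blast
  have mult: "A \<circ> B \<in> ?H" if "A \<in> ?H" "B \<in> ?H" for A B
  proof -
    from that obtain a b a' b' where "A = pauli_op 0 a b" "B = pauli_op 0 a' b'"
      and mem: "a \<in> xspan f K" "b \<in> xspan g M" "a' \<in> xspan f K" "b' \<in> xspan g M" by auto
    then have "A \<circ> B = pauli_op 0 (a \<triangle> a') (b \<triangle> b')"
      by (simp add: pauli_op_comp_even even finb)
    with mem KM xspan_sdiff[of K a f a'] xspan_sdiff[of M b g b'] show ?thesis by blast
  qed
  have carrier: "?H \<subseteq> carrier (pauli_group Q)"
    unfolding carrier_pauli_group[OF Q] using subQ subQ' by blast
  show sg: "subgroup ?H (pauli_group Q)"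
  proof (rule subgroupI[OF carrier])
    show "?H \<noteq> {}" using xspan_empty[of f K] xspan_empty[of g M] by auto
    show "inv\<^bsub>pauli_group Q\<^esub> A \<in> ?H" if A: "A \<in> ?H" for A
    proof -
      from A obtain a b where "A = pauli_op 0 a b" "a \<in> xspan f K" "b \<in> xspan g M" by auto
      \<comment> \<open>The symmetric difference of a set with itself is empty and the overlap is
        even, so every element is its own inverse.\<close>
      then have "A \<circ> A = id" by (simp add: pauli_op_comp_even even finb pauli_op_id)
      then have "inv\<^bsub>pauli_group Q\<^esub> A = A" using A carrier by (intro inv_equality) auto
      with A show ?thesis by simp
    qed
  qed (use mult in auto)
  show "?L = ?H"
  proof
    show "?L \<subseteq> ?H"
    proof (rule generate_subgroup_incl[OF _ sg])
      have "pauli_op 0 (f i) {} \<in> ?H" if "i \<in> K" for i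
        by (rule memH[OF xspan_base[OF that] xspan_empty])
      moreover have "pauli_op 0 {} (g i) \<in> ?H" if "i \<in> M" for i
        by (rule memH[OF xspan_empty xspan_base[OF that]])
      ultimately show "css_generators f K g M \<subseteq> ?H"
        unfolding css_generators_def by (intro Un_least image_subsetI)
    qed
    show "?H \<subseteq> ?L"
    proof
      fix A assume "A \<in> ?H"
      then obtain N N' where N: "A = pauli_op 0 (xsum f N) (xsum g N')" "N \<subseteq> K" "N' \<subseteq> M"
        by (auto simp: xspan_def)
      have "finite (xsum g N')" using N finb[of "xsum g N'"] by (auto simp: xspan_def)
      then have "A = pauli_op 0 {} (xsum g N') \<circ> pauli_op 0 (xsum f N) {}"
        by (simp add: N(1) pauli_op_comp_even)
      moreover have "pauli_op 0 (xsum f N) {} \<in> ?L"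
        by (rule generate_pauli_op_xsum[OF _ N(2)]) (use N KM finite_subset in \<open>auto simp: css_generators_def\<close>)
      moreover have "pauli_op 0 {} (xsum g N') \<in> ?L"
        by (rule generate_pauli_op_xsum_Z[OF _ N(3)]) (use N KM finite_subset fin' in \<open>auto simp: css_generators_def\<close>)
      ultimately show "A \<in> ?L" using generate.eng[of _ "pauli_group Q"] by fastforce
    qed
  qed
qed

text \<open>\<open>lX\<close> and \<open>lZ\<close> are dual families supporting the logical
  operators of all encoded qubits, gauge qubits included. Completeness of the families is not
  postulated; it follows from the count \<open>card_Q\<close>.\<close>

locale css_code =
  fixes Q :: "'q set"
    and IX :: "'i set" and gX :: "'i \<Rightarrow> 'q set"
    and IZ :: "'k set" and gZ :: "'k \<Rightarrow> 'q set"
    and J :: "'j set" and lX lZ :: "'j \<Rightarrow> 'q set"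
  assumes finite: "finite Q" "finite IX" "finite IZ" "finite J"
    and gX_subset: "i \<in> IX \<Longrightarrow> gX i \<subseteq> Q" and gZ_subset: "k \<in> IZ \<Longrightarrow> gZ k \<subseteq> Q"
    and lX_subset: "j \<in> J \<Longrightarrow> lX j \<subseteq> Q" and lZ_subset: "j \<in> J \<Longrightarrow> lZ j \<subseteq> Q"
    and gX_gZ: "i \<in> IX \<Longrightarrow> k \<in> IZ \<Longrightarrow> \<not> odd_overlap (gX i) (gZ k)"
    and gX_lZ: "i \<in> IX \<Longrightarrow> j \<in> J \<Longrightarrow> \<not> odd_overlap (gX i) (lZ j)"
    and gZ_lX: "k \<in> IZ \<Longrightarrow> j \<in> J \<Longrightarrow> \<not> odd_overlap (gZ k) (lX j)"
    and lX_lZ: "j \<in> J \<Longrightarrow> j' \<in> J \<Longrightarrow> odd_overlap (lX j) (lZ j') \<longleftrightarrow> j = j'"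
    and gX_indep: "K \<subseteq> IX \<Longrightarrow> xsum gX K = {} \<Longrightarrow> K = {}"
    and gZ_indep: "M \<subseteq> IZ \<Longrightarrow> xsum gZ M = {} \<Longrightarrow> M = {}"
    and card_Q: "card Q = card IX + card IZ + card J"
begin

text \<open>All assumptions are symmetric under exchanging X and Z, so each result about X parts
  yields its Z counterpart by reinterpretation.\<close>

lemma dual: "css_code Q IZ gZ IX gX J lZ lX"
  using finite gX_subset gZ_subset lX_subset lZ_subset gX_gZ gX_lZ gZ_lX lX_lZ gX_indep gZ_indep card_Q
  by unfold_locales (auto simp: odd_overlap_commute)

lemma finite_subset_Q: "a \<subseteq> Q \<Longrightarrow> Finite_Set.finite a"
  using finite(1) by (rule finite_subset[rotated])

lemma finite_gX: "i \<in> IX \<Longrightarrow> Finite_Set.finite (gX i)"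
  and finite_gZ: "k \<in> IZ \<Longrightarrow> Finite_Set.finite (gZ k)"
  and finite_lX: "j \<in> J \<Longrightarrow> Finite_Set.finite (lX j)"
  and finite_lZ: "j \<in> J \<Longrightarrow> Finite_Set.finite (lZ j)"
  using gX_subset gZ_subset lX_subset lZ_subset finite_subset_Q by auto

lemma odd_overlap_xsum_lX:
  assumes "M \<subseteq> J" "j \<in> J"
  shows "odd_overlap (xsum lX M) (lZ j) \<longleftrightarrow> j \<in> M"
  using assms finite_subset[OF assms(1) finite(4)] finite_lX lX_lZ
  by (intro odd_overlap_xsum_dual) auto

lemma odd_overlap_xsum_lZ:
  assumes "M \<subseteq> J" "j \<in> J"
  shows "odd_overlap (xsum lZ M) (lX j) \<longleftrightarrow> j \<in> M"
  using assms finite_subset[OF assms(1) finite(4)] finite_lZ lX_lZ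
  by (intro odd_overlap_xsum_dual) (auto simp: odd_overlap_commute)

lemma not_odd_overlap_xsum_lX:
  assumes "M \<subseteq> J" "k \<in> IZ"
  shows "\<not> odd_overlap (xsum lX M) (gZ k)"
  using assms finite_subset[OF assms(1) finite(4)] finite_lX gZ_lX
  by (intro not_odd_overlap_xsum) (auto simp: odd_overlap_commute)

lemma xsum_lX_subset: "M \<subseteq> J \<Longrightarrow> xsum lX M \<subseteq> Q"
  using lX_subset by (intro xsum_subset) auto

lemma lZ_indep:
  assumes "M \<subseteq> J" "xsum lZ M = {}"
  shows "M = {}"
  using odd_overlap_xsum_lZ[OF assms(1)] assms by auto

lemma xspan_gX_subset: "a \<in> xspan gX IX \<Longrightarrow> a \<subseteq> Q"
  using gX_subset by (rule xspan_subset)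

lemma xspan_gZ_subset: "b \<in> xspan gZ IZ \<Longrightarrow> b \<subseteq> Q"
  using gZ_subset by (rule xspan_subset)

lemma xspan_gX_gZ: "a \<in> xspan gX IX \<Longrightarrow> k \<in> IZ \<Longrightarrow> \<not> odd_overlap a (gZ k)"
  by (rule not_odd_overlap_xspan[OF finite(2) finite_gX gX_gZ])

lemma xspan_gX_lZ: "a \<in> xspan gX IX \<Longrightarrow> j \<in> J \<Longrightarrow> \<not> odd_overlap a (lZ j)"
  by (rule not_odd_overlap_xspan[OF finite(2) finite_gX gX_lZ])

lemma xspan_gZ_lX: "b \<in> xspan gZ IZ \<Longrightarrow> j \<in> J \<Longrightarrow> \<not> odd_overlap b (lX j)"
  by (rule not_odd_overlap_xspan[OF finite(3) finite_gZ gZ_lX])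

text \<open>The \<open>gZ\<close> and \<open>lZ\<close> together are independent, so their common orthogonal complement has the
  cardinality of the span of \<open>gX\<close>, which it contains.\<close>

lemma xspan_gX_complete:
  assumes "a \<subseteq> Q" "\<And>k. k \<in> IZ \<Longrightarrow> \<not> odd_overlap a (gZ k)" "\<And>j. j \<in> J \<Longrightarrow> \<not> odd_overlap a (lZ j)"
  shows "a \<in> xspan gX IX"
proof -
  define V where "V = (\<lambda>(s, t). s \<triangle> t) ` (xspan gZ IZ \<times> xspan lZ J)"
  define P where "P = {w. w \<subseteq> Q \<and> (\<forall>v\<in>V. \<not> odd_overlap v w)}"
  have subs: "s \<subseteq> Q" "t \<subseteq> Q" if "s \<in> xspan gZ IZ" "t \<in> xspan lZ J" for s t
    using that xspan_gZ_subset xspan_subset[of J lZ Q] lZ_subset by auto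
  have fin: "Finite_Set.finite s" "Finite_Set.finite t"
    if "s \<in> xspan gZ IZ" "t \<in> xspan lZ J" for s t
    using subs[OF that] finite_subset_Q by auto
  \<comment> \<open>The span of \<open>gZ\<close> is orthogonal to every \<open>lX j\<close>, while
    \<open>lX j\<close> reads off coefficients in the span of \<open>lZ\<close>. Hence the sum of
    the two spans is direct.\<close>
  have inj: "inj_on (\<lambda>(s, t). s \<triangle> t) (xspan gZ IZ \<times> xspan lZ J)"
  proof (rule inj_onI, clarify)
    fix s t s' t'
    assume st: "s \<in> xspan gZ IZ" "t \<in> xspan lZ J" "s' \<in> xspan gZ IZ" "t' \<in> xspan lZ J"
      and eq: "s \<triangle> t = s' \<triangle> t'"
    obtain M N where M: "t = xsum lZ M" "M \<subseteq> J" and N: "t' = xsum lZ N" "N \<subseteq> J"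
      using st by (auto simp: xspan_def)
    have "j \<in> M \<longleftrightarrow> j \<in> N" if j: "j \<in> J" for j
    proof -
      have "odd_overlap (s \<triangle> t) (lX j) = odd_overlap (s' \<triangle> t') (lX j)" using eq by simp
      then have "odd_overlap t (lX j) = odd_overlap t' (lX j)"
        using st fin xspan_gZ_lX[OF _ j] by (simp add: odd_overlap_sdiff)
      then show ?thesis using odd_overlap_xsum_lZ M N j by auto
    qed
    then have t: "t = t'" using M N by (metis subsetD subset_antisym subsetI)
    moreover from eq t have "s = s'" by (metis sdiff_commute sdiff_cancel)
    ultimately show "s = s' \<and> t = t'" by simp
  qed
  have cardV: "card V = 2 ^ card IZ * 2 ^ card J"
    unfolding V_def card_image[OF inj] card_cartesian_product
    using card_xspan[OF finite(3), where f = gZ] gZ_indep card_xspan[OF finite(4), where f = lZ] lZ_indep by simp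
  have "card V * card P = 2 ^ card Q"
    unfolding P_def
  proof (rule card_mult_card_orthogonal[OF finite(1)])
    show "V \<subseteq> Pow Q" unfolding V_def
      using xspan_gZ_subset[THEN subsetD] subs(2)[OF xspan_empty, THEN subsetD]
      by (auto simp: sdiff_def)
    show "{} \<in> V" unfolding V_def using xspan_empty[of gZ IZ] xspan_empty[of lZ J]
      by (auto intro!: image_eqI[of _ _ "({}, {})"])
    fix v w assume "v \<in> V" "w \<in> V"
    then obtain s t s' t' where v: "v = s \<triangle> t" "w = s' \<triangle> t'"
      and st: "s \<in> xspan gZ IZ" "t \<in> xspan lZ J" "s' \<in> xspan gZ IZ" "t' \<in> xspan lZ J"
      by (auto simp: V_def)
    then have "v \<triangle> w = (s \<triangle> s') \<triangle> (t \<triangle> t')" by auto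
    moreover have "s \<triangle> s' \<in> xspan gZ IZ" by (rule xspan_sdiff[OF finite(3) st(1,3)])
    moreover have "t \<triangle> t' \<in> xspan lZ J" by (rule xspan_sdiff[OF finite(4) st(2,4)])
    ultimately show "v \<triangle> w \<in> V"
      unfolding V_def by (intro image_eqI[of _ _ "(s \<triangle> s', t \<triangle> t')"]) auto
  qed
  then have "(2 ^ (card IZ + card J)) * card P = (2 ^ (card IZ + card J)) * (2 ^ card IX :: nat)"
    unfolding cardV card_Q by (simp add: power_add ac_simps)
  then have cardP: "card P = card (xspan gX IX)"
    using card_xspan[OF finite(2), where f = gX] gX_indep by simp
  have memP: "w \<in> P" if "w \<subseteq> Q" "\<And>k. k \<in> IZ \<Longrightarrow> \<not> odd_overlap w (gZ k)"
    "\<And>j. j \<in> J \<Longrightarrow> \<not> odd_overlap w (lZ j)" for w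
  proof -
    have "\<not> odd_overlap (s \<triangle> t) w" if st: "s \<in> xspan gZ IZ" "t \<in> xspan lZ J" for s t
    proof -
      have "\<not> odd_overlap s w"
        by (rule not_odd_overlap_xspan[OF finite(3) finite_gZ _ st(1)])
          (use \<open>\<And>k. k \<in> IZ \<Longrightarrow> \<not> odd_overlap w (gZ k)\<close> in \<open>auto simp: odd_overlap_commute\<close>)
      moreover have "\<not> odd_overlap t w"
        by (rule not_odd_overlap_xspan[OF finite(4) finite_lZ _ st(2)])
          (use \<open>\<And>j. j \<in> J \<Longrightarrow> \<not> odd_overlap w (lZ j)\<close> in \<open>auto simp: odd_overlap_commute\<close>)
      ultimately show ?thesis using fin[OF st] by (simp add: odd_overlap_sdiff)
    qed
    then show ?thesis using \<open>w \<subseteq> Q\<close> by (auto simp: P_def V_def)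
  qed
  \<comment> \<open>One inclusion is orthogonality; equal finite cardinality gives the
    other.\<close>
  have "xspan gX IX \<subseteq> P" using xspan_gX_subset xspan_gX_gZ xspan_gX_lZ memP by auto
  moreover have "Finite_Set.finite P" unfolding P_def using finite(1) by simp
  ultimately have "xspan gX IX = P" using cardP by (metis card_subset_eq)
  then show ?thesis using memP assms by auto
qed

text \<open>The added combination of \<open>lX\<close> has the same pairings with all
  \<open>lZ j\<close> as \<open>a\<close>. The remainder is therefore orthogonal to both
  \<open>gZ\<close> and \<open>lZ\<close>, and completeness places it in the span of
  \<open>gX\<close>.\<close>

lemma decompose_X:
  assumes "a \<subseteq> Q" "\<And>k. k \<in> IZ \<Longrightarrow> \<not> odd_overlap a (gZ k)"
  shows "a \<triangle> xsum lX {j \<in> J. odd_overlap a (lZ j)} \<in> xspan gX IX"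
proof -
  let ?M = "{j \<in> J. odd_overlap a (lZ j)}"
  have M: "?M \<subseteq> J" by auto
  have fin: "Finite_Set.finite a" "Finite_Set.finite (xsum lX ?M)"
    using assms(1) xsum_lX_subset[OF M] finite_subset_Q by auto
  show ?thesis
  proof (rule xspan_gX_complete)
    show "a \<triangle> xsum lX ?M \<subseteq> Q" using assms(1) xsum_lX_subset[OF M] by (rule sdiff_subset)
  qed (use fin assms(2) not_odd_overlap_xsum_lX[OF M] odd_overlap_xsum_lX[OF M] in
      \<open>auto simp: odd_overlap_sdiff\<close>)
qed

end

section \<open>The stabilizer group, its code space and its logical operators\<close>

lemma sum_fun_apply: "(\<Sum>i\<in>A. f i) c = (\<Sum>i\<in>A. f i c :: complex)"
  by (induction A rule: infinite_finite_induct) auto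

lemma vector_space_fun: "vector_space (\<lambda>(a::complex) \<psi> c. a * \<psi> c)"
  by unfold_locales (auto simp: fun_eq_iff algebra_simps)

context css_code
begin

definition stabs :: "'q operator set" where
  "stabs = generate (pauli_group Q) (css_generators gX IX gZ IZ)"

lemma stabs_eq: "stabs = {pauli_op 0 a b | a b. a \<in> xspan gX IX \<and> b \<in> xspan gZ IZ}"
  and subgroup_stabs: "subgroup stabs (pauli_group Q)"
  using generate_css_generators[of Q IX IZ gX gZ] finite gX_subset gZ_subset gX_gZ
  by (simp_all add: stabs_def)

lemma finite_xspan_gZ: "b \<in> xspan gZ IZ \<Longrightarrow> Finite_Set.finite b"
  using xspan_gZ_subset finite_subset_Q by auto

lemma xspan_gX_xspan_gZ:
  assumes "a \<in> xspan gX IX" "b \<in> xspan gZ IZ"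
  shows "\<not> odd_overlap a b"
proof -
  have "\<not> odd_overlap b a"
    by (rule not_odd_overlap_xspan[OF finite(3) finite_gZ _ assms(2)])
      (use xspan_gX_gZ[OF assms(1)] in \<open>auto simp: odd_overlap_commute\<close>)
  then show ?thesis by (simp add: odd_overlap_commute)
qed

lemma pauli_op_X_in_stabs: "a \<in> xspan gX IX \<Longrightarrow> pauli_op 0 a {} \<in> stabs"
  and pauli_op_Z_in_stabs: "b \<in> xspan gZ IZ \<Longrightarrow> pauli_op 0 {} b \<in> stabs"
  unfolding stabs_eq using xspan_empty[of gX IX] xspan_empty[of gZ IZ] by auto

lemma commute_stabs:
  assumes "A \<in> stabs" "B \<in> stabs"
  shows "commute A B"
  using assms finite_xspan_gZ xspan_gX_xspan_gZ by (auto simp: stabs_eq commute_pauli_op)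

lemma comm_group_stabs: "comm_group (pauli_group Q\<lparr>carrier := stabs\<rparr>)"
proof -
  interpret group "pauli_group Q" using finite(1) by (rule group_pauli_group)
  have "group (pauli_group Q\<lparr>carrier := stabs\<rparr>)"
    using subgroup.subgroup_is_group[OF subgroup_stabs] is_group by blast
  then show ?thesis
    by (rule group.group_comm_groupI) (use commute_stabs in \<open>auto simp: commute_def\<close>)
qed

lemma inj_on_gX: "inj_on gX IX"
proof (rule inj_onI)
  fix i i' assume i: "i \<in> IX" "i' \<in> IX" "gX i = gX i'"
  then have "xsum gX ({i} \<triangle> {i'}) = {}" by (simp add: xsum_sdiff)
  then have "{i} \<triangle> {i'} = {}" using i by (intro gX_indep) auto
  then show "i = i'" by (simp add: sdiff_eq_empty_iff)
qed

lemma gX_nonempty: "i \<in> IX \<Longrightarrow> gX i \<noteq> {}"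
  using gX_indep[of "{i}"] by auto

lemma card_css_generators: "card (css_generators gX IX gZ IZ) = card IX + card IZ"
proof -
  interpret dual: css_code Q IZ gZ IX gX J lZ lX by (rule dual)
  have "inj_on (\<lambda>i. pauli_op 0 (gX i) {}) IX"
    using inj_on_gX by (auto simp: inj_on_def pauli_op_eq_iff)
  moreover have "inj_on (\<lambda>k. pauli_op 0 {} (gZ k)) IZ"
    using dual.inj_on_gX finite_gZ by (auto simp: inj_on_def pauli_op_eq_iff)
  moreover have "(\<lambda>i. pauli_op 0 (gX i) {}) ` IX \<inter> (\<lambda>k. pauli_op 0 {} (gZ k)) ` IZ = {}"
    using gX_nonempty finite_gZ by (auto simp: pauli_op_eq_iff)
  ultimately show ?thesis unfolding css_generators_def using finite
    by (simp add: card_Un_disjoint card_image)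
qed

lemma gX_notin_xspan:
  assumes "i \<in> IX"
  shows "gX i \<notin> xspan gX (IX - {i})"
proof
  assume "gX i \<in> xspan gX (IX - {i})"
  then obtain M where M: "M \<subseteq> IX - {i}" "gX i = xsum gX M" by (auto simp: xspan_def)
  then have "Finite_Set.finite M" "i \<notin> M" using finite(2) finite_subset[of M IX] by auto
  then have "xsum gX (insert i M) = {}" by (simp add: xsum_insert flip: M(2))
  then have "insert i M = {}" by (rule gX_indep[rotated]) (use M assms in auto)
  then show False by simp
qed

lemma independent_css_generators: "independent_generators Q (css_generators gX IX gZ IZ)"
  unfolding independent_generators_def
proof
  interpret dual: css_code Q IZ gZ IX gX J lZ lX by (rule dual)
  interpret group "pauli_group Q" using finite(1) by (rule group_pauli_group)
  fix A assume A: "A \<in> css_generators gX IX gZ IZ"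
  \<comment> \<open>Removing one generator leaves a set inside a smaller pure-type family, whose
    generated group is again known explicitly. Independence in the group is thus reduced to
    independence of the supports of one type.\<close>
  have incl: "generate (pauli_group Q) (css_generators gX IX gZ IZ - {A}) \<subseteq>
      {pauli_op 0 a b | a b. a \<in> xspan gX K \<and> b \<in> xspan gZ M}"
    if KM: "K \<subseteq> IX" "M \<subseteq> IZ" and "css_generators gX IX gZ IZ - {A} \<subseteq> css_generators gX K gZ M" for K M
  proof -
    have "generate (pauli_group Q) (css_generators gX IX gZ IZ - {A}) \<subseteq>
        generate (pauli_group Q) (css_generators gX K gZ M)"
      using that(3) by (rule mono_generate)
    also have "\<dots> = {pauli_op 0 a b | a b. a \<in> xspan gX K \<and> b \<in> xspan gZ M}"
      by (rule generate_css_generators(1)[OF finite(1) finite_subset[OF KM(1) finite(2)]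
            finite_subset[OF KM(2) finite(3)]])
        (use KM gX_subset gZ_subset gX_gZ in blast)+
    finally show ?thesis .
  qed
  from A consider (X) i where "i \<in> IX" "A = pauli_op 0 (gX i) {}"
    | (Z) k where "k \<in> IZ" "A = pauli_op 0 {} (gZ k)" by (auto simp: css_generators_def)
  then show "A \<notin> generate (pauli_group Q) (css_generators gX IX gZ IZ - {A})"
  proof cases
    case X
    have "css_generators gX IX gZ IZ - {A} \<subseteq> css_generators gX (IX - {i}) gZ IZ"
      using X by (auto simp: css_generators_def)
    from incl[OF _ _ this] show ?thesis
      using gX_notin_xspan[OF X(1)] finite_xspan_gZ by (fastforce simp: X pauli_op_eq_iff)
  next
    case Z
    have "css_generators gX IX gZ IZ - {A} \<subseteq> css_generators gX IX gZ (IZ - {k})"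
      using Z by (auto simp: css_generators_def)
    note * = incl[OF _ _ this]
    have fin: "Finite_Set.finite b" if "b \<in> xspan gZ (IZ - {k})" for b
      using that finite_xspan_gZ[of b] by (auto simp: xspan_def)
    show ?thesis
    proof
      assume "A \<in> generate (pauli_group Q) (css_generators gX IX gZ IZ - {A})"
      with * obtain a b where "A = pauli_op 0 a b" "b \<in> xspan gZ (IZ - {k})" by fastforce
      then show False using dual.gX_notin_xspan[OF Z(1)] fin[of b] finite_gZ[OF Z(1)]
        by (auto simp: Z pauli_op_eq_iff)
    qed
  qed
qed

text \<open>Commutation with the whole group need only be tested on generators: an X check sees the
  Z part alone, a Z check the X part alone, and bilinearity extends the test to spans.\<close>

lemma pauli_op_in_logical_operators_iff:
  assumes "a \<subseteq> Q" "b \<subseteq> Q"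
  shows "pauli_op k a b \<in> logical_operators Q stabs \<longleftrightarrow>
    (\<forall>k\<in>IZ. \<not> odd_overlap a (gZ k)) \<and> (\<forall>i\<in>IX. \<not> odd_overlap (gX i) b)" (is "_ \<longleftrightarrow> ?R")
proof -
  have fin: "Finite_Set.finite b" using assms(2) by (rule finite_subset_Q)
  have "pauli_op k a b \<in> carrier (pauli_group Q)"
    using assms by (auto simp: carrier_pauli_group[OF finite(1)])
  moreover have "(\<forall>B\<in>stabs. commute (pauli_op k a b) B) \<longleftrightarrow> ?R"
  proof
    assume *: "\<forall>B\<in>stabs. commute (pauli_op k a b) B"
    have "\<not> odd_overlap a (gZ k)" if "k \<in> IZ" for k
      using *[rule_format, OF pauli_op_Z_in_stabs[OF xspan_base[OF that]]] fin finite_gZ[OF that]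
      by (simp add: commute_pauli_op)
    moreover have "\<not> odd_overlap (gX i) b" if "i \<in> IX" for i
      using *[rule_format, OF pauli_op_X_in_stabs[OF xspan_base[OF that]]] fin
      by (simp add: commute_pauli_op)
    ultimately show ?R by blast
  next
    assume ?R
    then have "\<not> odd_overlap s b" "\<not> odd_overlap t a" if "s \<in> xspan gX IX" "t \<in> xspan gZ IZ" for s t
      using not_odd_overlap_xspan[OF finite(2) finite_gX _ that(1)]
        not_odd_overlap_xspan[OF finite(3) finite_gZ _ that(2)] by (auto simp: odd_overlap_commute)
    then show "\<forall>B\<in>stabs. commute (pauli_op k a b) B"
      using fin finite_xspan_gZ by (auto simp: stabs_eq commute_pauli_op odd_overlap_commute[of a])
  qed
  ultimately show ?thesis by (simp add: logical_operators_def)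
qed

text \<open>\<open>codeword M\<close> is the superposition of all basis states satisfying the \<open>Z\<close> checks on which
  exactly the \<open>Z\<close>-type logical operators with index in \<open>M\<close> have eigenvalue \<open>- 1\<close>.\<close>

definition codeword :: "'j set \<Rightarrow> 'q state" where
  "codeword M = (\<lambda>c. of_bool (Collect c \<subseteq> Q \<and> (\<forall>k\<in>IZ. \<not> odd_overlap (Collect c) (gZ k)) \<and>
     {j \<in> J. odd_overlap (Collect c) (lZ j)} = M))"

text \<open>The bit string \<open>xsum lX N\<close> is a representative of the class
  \<open>N\<close>; evaluation at these representatives is dual to the codewords.\<close>

lemma codeword_apply:
  assumes "N \<subseteq> J"
  shows "codeword M (\<lambda>q. q \<in> xsum lX N) = of_bool (N = M)"
proof -
  have "{j \<in> J. odd_overlap (xsum lX N) (lZ j)} = N"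
    using assms odd_overlap_xsum_lX[OF assms] by auto
  then show ?thesis
    using xsum_lX_subset[OF assms] not_odd_overlap_xsum_lX[OF assms] by (simp add: codeword_def)
qed

lemma codeword_in_code_space: "codeword M \<in> code_space Q stabs"
proof -
  have "pauli_op 0 a b (codeword M) c = codeword M c"
    if a: "a \<in> xspan gX IX" and b: "b \<in> xspan gZ IZ" for a b c
  proof -
    have shift: "Collect (\<lambda>j. c j \<noteq> (j \<in> a)) = Collect c \<triangle> a" by auto
    have sub: "Collect c \<triangle> a \<subseteq> Q \<longleftrightarrow> Collect c \<subseteq> Q"
      using xspan_gX_subset[OF a] by (auto simp: subset_iff)
    \<comment> \<open>An X stabilizer shifts basis states by \<open>a\<close>, which is orthogonal
      to all \<open>gZ\<close> and \<open>lZ\<close>, so neither the checks nor the class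
      change.\<close>
    have inv: "codeword M (\<lambda>j. c j \<noteq> (j \<in> a)) = codeword M c"
    proof (cases "Collect c \<subseteq> Q")
      case True
      then have "Finite_Set.finite (Collect c)" "Finite_Set.finite a"
        using finite_subset_Q xspan_gX_subset[OF a] by auto
      then have "k \<in> IZ \<Longrightarrow> odd_overlap (Collect c \<triangle> a) (gZ k) = odd_overlap (Collect c) (gZ k)"
        "j \<in> J \<Longrightarrow> odd_overlap (Collect c \<triangle> a) (lZ j) = odd_overlap (Collect c) (lZ j)" for k j
        using xspan_gX_gZ[OF a] xspan_gX_lZ[OF a] by (simp_all add: odd_overlap_sdiff)
      then show ?thesis unfolding codeword_def shift sub by (simp cong: conj_cong)
    qed (unfold codeword_def shift sub, simp)
    show ?thesis
    proof (cases "codeword M c = 0")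
      case False
      then have "\<not> odd_overlap (Collect c) (gZ k)" if "k \<in> IZ" for k
        using that by (auto simp: codeword_def)
      \<comment> \<open>Where the codeword is nonzero every Z check is satisfied, so a Z stabilizer
        acts there with sign +1.\<close>
      then have "\<not> odd_overlap b (Collect c)"
        by (intro not_odd_overlap_xspan[OF finite(3) finite_gZ _ b]) (auto simp: odd_overlap_commute)
      moreover have "{j \<in> b. c j} = b \<inter> Collect c" by auto
      ultimately show ?thesis unfolding pauli_op_def inv by (simp add: odd_overlap_def)
    qed (unfold pauli_op_def inv, simp)
  qed
  then show ?thesis
    by (auto simp: code_space_def stabs_eq states_on_def codeword_def intro!: ext)
qed

text \<open>Invariance under X stabilizers lets \<open>c\<close> be moved to the representative of
  its class by \<open>decompose_X\<close>; a violated Z check forces the amplitude to equal its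
  negative, hence to vanish.\<close>

lemma code_space_apply:
  assumes \<psi>: "\<psi> \<in> code_space Q stabs"
  shows "\<psi> c = (\<Sum>M\<in>Pow J. \<psi> (\<lambda>q. q \<in> xsum lX M) * codeword M c)"
proof (cases "Collect c \<subseteq> Q \<and> (\<forall>k\<in>IZ. \<not> odd_overlap (Collect c) (gZ k))")
  case True
  define N where "N = {j \<in> J. odd_overlap (Collect c) (lZ j)}"
  define a where "a = Collect c \<triangle> xsum lX N"
  have "a \<in> xspan gX IX" unfolding a_def N_def using True by (intro decompose_X) auto
  then have inv: "pauli_op 0 a {} \<psi> = \<psi>" using \<psi> pauli_op_X_in_stabs by (auto simp: code_space_def)
  have shift: "(\<lambda>q. c q \<noteq> (q \<in> a)) = (\<lambda>q. q \<in> xsum lX N)" by (auto simp: a_def)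
  have "\<psi> c = \<psi> (\<lambda>q. q \<in> xsum lX N)"
    using fun_cong[OF inv, of c] unfolding pauli_op_def shift by simp
  moreover have "codeword M c = (if N = M then 1 else 0)" for M
    using True by (simp add: codeword_def N_def)
  moreover have "N \<in> Pow J" by (auto simp: N_def)
  ultimately show ?thesis using finite(4)
    by (simp only: if_distrib[of "(*) _"] mult_1_right mult_zero_right sum.delta' finite_Pow_iff if_True)
next
  case False
  have "\<psi> c = 0"
  proof (rule ccontr)
    assume nz: "\<psi> c \<noteq> 0"
    then have "Collect c \<subseteq> Q" using \<psi> by (auto simp: code_space_def states_on_def)
    with False obtain k where k: "k \<in> IZ" "odd_overlap (Collect c) (gZ k)" by auto
    have "pauli_op 0 {} (gZ k) \<psi> = \<psi>"
      using \<psi> pauli_op_Z_in_stabs[OF xspan_base[OF k(1)]] by (auto simp: code_space_def)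
    from fun_cong[OF this, of c] have "(- 1) ^ card {j \<in> gZ k. c j} * \<psi> c = \<psi> c"
      by (simp add: pauli_op_def)
    moreover have "{j \<in> gZ k. c j} = Collect c \<inter> gZ k" by auto
    ultimately show False using k(2) nz by (simp add: odd_overlap_def)
  qed
  moreover have "codeword M c = 0" for M using False by (auto simp: codeword_def)
  ultimately show ?thesis by simp
qed

lemma complex_dim_code_space: "complex_dim (code_space Q stabs) = 2 ^ card J"
proof -
  interpret vec: vector_space "\<lambda>(a::complex) (\<psi>::'q state) c. a * \<psi> c" by (rule vector_space_fun)
  let ?B = "codeword ` Pow J"
  have inj: "inj_on codeword (Pow J)"
  proof (rule inj_onI)
    fix M N assume "M \<in> Pow J" "N \<in> Pow J" "codeword M = codeword N"
    then show "M = N" using codeword_apply[of M M] codeword_apply[of M N] by auto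
  qed
  have finB: "Finite_Set.finite ?B" using finite(4) by simp
  have "\<not> vec.dependent ?B"
  proof
    assume "vec.dependent ?B"
    then obtain u M where u: "(\<Sum>v\<in>?B. (\<lambda>c. u v * v c)) = 0" and M: "M \<subseteq> J" "u (codeword M) \<noteq> 0"
      unfolding vec.dependent_finite[OF finB] by auto
    \<comment> \<open>Evaluating the linear relation at the representative of \<open>M\<close>
      singles out the coefficient of \<open>codeword M\<close>.\<close>
    have "0 = (\<Sum>v\<in>?B. u v * v (\<lambda>q. q \<in> xsum lX M))"
      using fun_cong[OF u, of "\<lambda>q. q \<in> xsum lX M"] by (simp add: sum_fun_apply)
    also have "\<dots> = (\<Sum>N\<in>Pow J. u (codeword N) * of_bool (M = N))"
      by (simp add: sum.reindex[OF inj] codeword_apply[OF M(1)])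
    also have "\<dots> = u (codeword M)"
      using M(1) finite(4)
      by (simp add: of_bool_def if_distrib[of "(*) _"] sum.delta' cong: if_cong)
    finally show False using M(2) by simp
  qed
  moreover have "code_space Q stabs \<subseteq> vec.span ?B"
  proof
    fix \<psi> assume \<psi>: "\<psi> \<in> code_space Q stabs"
    have "\<psi> = (\<Sum>M\<in>Pow J. (\<lambda>c. \<psi> (\<lambda>q. q \<in> xsum lX M) * codeword M c))"
      by (rule ext, unfold sum_fun_apply, rule code_space_apply[OF \<psi>])
    also have "\<dots> \<in> vec.span ?B"
      by (intro vec.span_sum vec.span_scale vec.span_base) auto
    finally show "\<psi> \<in> vec.span ?B" .
  qed
  moreover have "?B \<subseteq> code_space Q stabs" using codeword_in_code_space by auto
  moreover have "card ?B = 2 ^ card J" using finite(4) by (simp add: card_image[OF inj] card_Pow)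
  ultimately show ?thesis unfolding complex_dim_def by (intro vec.dim_unique)
qed

lemma stabilizer_code_stabs: "stabilizer_code Q stabs (card J)"
proof -
  \<comment> \<open>\<open>- id\<close> has phase exponent 2, whereas every stabilizer has exponent
    0, and the normal form is unique up to the value of the phase.\<close>
  have "- id \<notin> stabs"
  proof
    assume "- id \<in> stabs"
    moreover have "- id = pauli_op 2 {} {}"
      using uminus_pauli_op[of 0 "{}" "{}"] by (simp only: pauli_op_id add_0)
    ultimately have "pauli_op 2 {} {} \<in> stabs" by (rule back_subst)
    then obtain a b where "pauli_op 2 {} {} = pauli_op 0 a b" "b \<in> xspan gZ IZ"
      unfolding stabs_eq by blast
    then show False using finite_xspan_gZ by (auto simp: pauli_op_eq_iff)
  qed
  then show ?thesis unfolding stabilizer_code_def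
    using subgroup_stabs commute_stabs complex_dim_code_space by blast
qed

lemma subgroup_logical_operators: "subgroup (logical_operators Q stabs) (pauli_group Q)"
proof -
  interpret group "pauli_group Q" using finite(1) by (rule group_pauli_group)
  show ?thesis
  proof (rule subgroupI)
    show "logical_operators Q stabs \<subseteq> carrier (pauli_group Q)" by (auto simp: logical_operators_def)
    have "pauli_op 0 {} {} \<in> logical_operators Q stabs" by (subst pauli_op_in_logical_operators_iff) auto
    then show "logical_operators Q stabs \<noteq> {}" by blast
    show "A \<otimes>\<^bsub>pauli_group Q\<^esub> B \<in> logical_operators Q stabs"
      if "A \<in> logical_operators Q stabs" "B \<in> logical_operators Q stabs" for A B
    proof -
      have "commute (A \<circ> B) C" if "commute A C" "commute B C" for C
        using that unfolding commute_def by (metis comp_assoc)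
      then show ?thesis using that m_closed[of A B] by (auto simp: logical_operators_def)
    qed
    show "inv\<^bsub>pauli_group Q\<^esub> A \<in> logical_operators Q stabs" if A: "A \<in> logical_operators Q stabs" for A
    proof -
      have carr: "A \<in> carrier (pauli_group Q)" using A by (auto simp: logical_operators_def)
      have "commute (inv\<^bsub>pauli_group Q\<^esub> A) C" if C: "commute A C" for C
      proof -
        let ?I = "inv\<^bsub>pauli_group Q\<^esub> A"
        have inv: "?I \<circ> A = id" "A \<circ> ?I = id" using l_inv[OF carr] r_inv[OF carr] by simp_all
        have "?I \<circ> C = ?I \<circ> C \<circ> (A \<circ> ?I)" using inv by simp
        also have "\<dots> = ?I \<circ> (C \<circ> A) \<circ> ?I" by (simp only: comp_assoc)
        also have "\<dots> = ?I \<circ> (A \<circ> C) \<circ> ?I" using C by (simp add: commute_def)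
        also have "\<dots> = (?I \<circ> A) \<circ> (C \<circ> ?I)" by (simp only: comp_assoc)
        finally show ?thesis using inv by (simp add: commute_def)
      qed
      then show ?thesis using A carr by (auto simp: logical_operators_def)
    qed
  qed
qed

text \<open>For the generation claim, the X and Z parts of a logical operator are each split by
  \<open>decompose_X\<close> (for Z, its dual) into a stabilizer and a product of the given logical
  operators; powers of \<open>phase 1\<close> supply the rest.\<close>

lemma logical_paulis_stabs:
  "logical_paulis Q stabs J (\<lambda>j. pauli_op 0 (lX j) {}) (\<lambda>j. pauli_op 0 {} (lZ j))"
proof -
  interpret dual: css_code Q IZ gZ IX gX J lZ lX by (rule dual)
  interpret group "pauli_group Q" using finite(1) by (rule group_pauli_group)
  let ?X = "\<lambda>j. pauli_op 0 (lX j) {}" and ?Z = "\<lambda>j. pauli_op 0 {} (lZ j)"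
  let ?G = "stabs \<union> {phase 1} \<union> ?X ` J \<union> ?Z ` J"
  have phase: "phase k = pauli_op k {} {}" for k
    using phase_comp_pauli_op[of k 0 "{}" "{}"] by (simp add: pauli_op_id)
  have log: "?X j \<in> logical_operators Q stabs" "?Z j \<in> logical_operators Q stabs" if "j \<in> J" for j
    using that lX_subset lZ_subset gZ_lX gX_lZ
    by (auto simp: pauli_op_in_logical_operators_iff odd_overlap_commute[of "lX j"])
  have "logical_operators Q stabs = generate (pauli_group Q) ?G"
  proof
    have "phase 1 \<in> logical_operators Q stabs"
      unfolding phase by (subst pauli_op_in_logical_operators_iff) auto
    moreover have "stabs \<subseteq> logical_operators Q stabs"
      using commute_stabs subgroup.subset[OF subgroup_stabs] by (auto simp: logical_operators_def)
    ultimately have "?G \<subseteq> logical_operators Q stabs" using log by auto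
    then show "generate (pauli_group Q) ?G \<subseteq> logical_operators Q stabs"
      using subgroup_logical_operators by (rule generate_subgroup_incl)
    have mult: "A \<circ> B \<in> generate (pauli_group Q) ?G"
      if "A \<in> generate (pauli_group Q) ?G" "B \<in> generate (pauli_group Q) ?G" for A B
      using generate.eng[OF that] by simp
    show "logical_operators Q stabs \<subseteq> generate (pauli_group Q) ?G"
    proof
      fix A assume A: "A \<in> logical_operators Q stabs"
      then obtain k a b where A_eq: "A = pauli_op k a b" and sub: "a \<subseteq> Q" "b \<subseteq> Q"
        by (auto simp: logical_operators_def carrier_pauli_group[OF finite(1)])
      with A have orth: "\<And>k. k \<in> IZ \<Longrightarrow> \<not> odd_overlap a (gZ k)" "\<And>i. i \<in> IX \<Longrightarrow> \<not> odd_overlap b (gX i)"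
        by (auto simp: pauli_op_in_logical_operators_iff odd_overlap_commute)
      define M where "M = {j \<in> J. odd_overlap a (lZ j)}"
      define N where "N = {j \<in> J. odd_overlap b (lX j)}"
      have MN: "M \<subseteq> J" "N \<subseteq> J" "Finite_Set.finite M" "Finite_Set.finite N"
        using finite(4) by (auto simp: M_def N_def)
      have "pauli_op 0 (a \<triangle> xsum lX M) {} \<in> generate (pauli_group Q) ?G"
        unfolding M_def using decompose_X[OF sub(1) orth(1)]
        by (intro generate.incl) (auto intro: pauli_op_X_in_stabs)
      moreover have "pauli_op 0 (xsum lX M) {} \<in> generate (pauli_group Q) ?G"
        by (rule generate_pauli_op_xsum[OF MN(3,1)]) auto
      ultimately have "pauli_op 0 (a \<triangle> xsum lX M) {} \<circ> pauli_op 0 (xsum lX M) {} \<in>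
          generate (pauli_group Q) ?G" by (rule mult)
      then have a: "pauli_op 0 a {} \<in> generate (pauli_group Q) ?G"
        by (simp add: pauli_op_comp_even sdiff_assoc)
      have fin: "Finite_Set.finite b" "Finite_Set.finite (xsum lZ N)"
        using sub(2) dual.xsum_lX_subset[OF MN(2)] finite_subset_Q by auto
      have "pauli_op 0 {} (b \<triangle> xsum lZ N) \<in> generate (pauli_group Q) ?G"
        unfolding N_def using dual.decompose_X[OF sub(2) orth(2)]
        by (intro generate.incl) (auto intro: pauli_op_Z_in_stabs)
      moreover have "pauli_op 0 {} (xsum lZ N) \<in> generate (pauli_group Q) ?G"
        by (rule generate_pauli_op_xsum_Z[OF MN(4,2)]) (use finite_lZ in auto)
      ultimately have "pauli_op 0 {} (b \<triangle> xsum lZ N) \<circ> pauli_op 0 {} (xsum lZ N) \<in>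
          generate (pauli_group Q) ?G" by (rule mult)
      then have b: "pauli_op 0 {} b \<in> generate (pauli_group Q) ?G"
        using fin by (simp add: pauli_op_comp_even sdiff_assoc)
      have "phase l \<in> generate (pauli_group Q) ?G" for l
      proof (induction l)
        case 0
        then show ?case using generate.one[of "pauli_group Q" ?G]
          by (simp only: phase pauli_op_id one_pauli_group)
      next
        case (Suc l)
        have "phase 1 \<in> generate (pauli_group Q) ?G" by (rule generate.incl) simp
        from mult[OF this Suc.IH] show ?case by (simp add: phase pauli_op_comp)
      qed
      \<comment> \<open>The factors are taken in the order phase, Z, X of the normal form, so that
        no sign appears.\<close>
      from mult[OF this mult[OF b a]] show "A \<in> generate (pauli_group Q) ?G"
        unfolding A_eq phase_comp_pauli_op using fin
        by (simp add: pauli_op_comp_even phase_comp_pauli_op)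
    qed
  qed
  then show ?thesis unfolding logical_paulis_def
    using log finite_lZ lX_lZ
    by (auto simp: commute_pauli_op anticommute_pauli_op pauli_op_comp_even pauli_op_id)
qed

end


section \<open>The surface code\<close>

lemma mem_qubits [simp]:
  "Vert x y \<in> qubits L \<longleftrightarrow> x \<le> L \<and> y \<le> L"
  "HEdge x y \<in> qubits L \<longleftrightarrow> x < L \<and> y \<le> L"
  "VEdge x y \<in> qubits L \<longleftrightarrow> x \<le> L \<and> y < L"
  by (auto simp: qubits_def)

lemma mem_horizontal_line [simp]:
  "Vert u v \<in> horizontal_line L y \<longleftrightarrow> u \<le> L \<and> v = y"
  "HEdge u v \<in> horizontal_line L y \<longleftrightarrow> u < L \<and> v = y"
  "VEdge u v \<notin> horizontal_line L y"
  by (auto simp: horizontal_line_def)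

lemma mem_vertical_line [simp]:
  "Vert u v \<in> vertical_line L x \<longleftrightarrow> v \<le> L \<and> u = x"
  "VEdge u v \<in> vertical_line L x \<longleftrightarrow> v < L \<and> u = x"
  "HEdge u v \<notin> vertical_line L x"
  by (auto simp: vertical_line_def)

lemma qubit_set_eqI:
  assumes "\<And>u v. Vert u v \<in> A \<longleftrightarrow> Vert u v \<in> B" "\<And>u v. HEdge u v \<in> A \<longleftrightarrow> HEdge u v \<in> B"
    "\<And>u v. VEdge u v \<in> A \<longleftrightarrow> VEdge u v \<in> B"
  shows "A = B"
proof (rule Set.set_eqI)
  show "q \<in> A \<longleftrightarrow> q \<in> B" for q using assms by (cases q) auto
qed

lemma qubit_subsetI:
  assumes "\<And>u v. Vert u v \<in> A \<Longrightarrow> Vert u v \<in> B" "\<And>u v. HEdge u v \<in> A \<Longrightarrow> HEdge u v \<in> B"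
    "\<And>u v. VEdge u v \<in> A \<Longrightarrow> VEdge u v \<in> B"
  shows "A \<subseteq> B"
proof
  show "q \<in> B" if "q \<in> A" for q using assms that by (cases q) auto
qed

lemma qubits_eq_image:
  "qubits L = case_prod Vert ` ({..L} \<times> {..L}) \<union> case_prod HEdge ` ({..<L} \<times> {..L}) \<union>
    case_prod VEdge ` ({..L} \<times> {..<L})"
  by (rule qubit_set_eqI) auto

lemma finite_qubits: "finite (qubits L)"
  by (simp add: qubits_eq_image)

lemma card_qubits: "card (qubits L) = 3 * L^2 + 4 * L + 1"
proof -
  have inj: "inj_on (case_prod Vert) A" "inj_on (case_prod HEdge) A" "inj_on (case_prod VEdge) A" for A
    by (auto simp: inj_on_def)
  have "card (qubits L) = (L + 1) * (L + 1) + L * (L + 1) + (L + 1) * L"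
    unfolding qubits_eq_image
    by (subst card_Un_disjoint; (subst card_Un_disjoint)?)
      (auto simp: card_image[OF inj(1)] card_image[OF inj(2)] card_image[OF inj(3)])
  then show ?thesis by (simp add: power2_eq_square algebra_simps)
qed

lemma horizontal_line_subset: "y \<le> L \<Longrightarrow> horizontal_line L y \<subseteq> qubits L"
  by (rule qubit_subsetI) auto

lemma vertical_line_subset: "x \<le> L \<Longrightarrow> vertical_line L x \<subseteq> qubits L"
  by (rule qubit_subsetI) auto

lemma finite_triangle: "finite (triangle c p)"
  by (cases c; cases p) auto

lemma triangle_subset: "p \<in> plaquettes L \<Longrightarrow> triangle c p \<subseteq> qubits L"
  by (cases c; cases p) (auto simp: plaquettes_def)

text \<open>
  A boundary stabilizer is what remains in the lattice of the plaquette stabilizer of a plaquette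
  adjacent to the boundary from outside. The check \<open>(x, y)\<close> of type \<open>X\<close> belongs to the plaquette
  with south-west corner \<open>(x - 1, y)\<close>, the check \<open>(x, y)\<close> of type \<open>Z\<close> to that with south-west
  corner \<open>(x, y - 1)\<close>.
\<close>

fun x_check :: "nat \<Rightarrow> nat \<times> nat \<Rightarrow> qubit set" where
  "x_check L (x, y) = {q. case q of
      Vert u v \<Rightarrow> u \<le> L \<and> (x = u + 1 \<and> v = y \<or> x = u \<and> v = y + 1)
    | HEdge u v \<Rightarrow> u < L \<and> x = u + 1 \<and> (v = y \<or> v = y + 1)
    | VEdge u v \<Rightarrow> u \<le> L \<and> v = y \<and> (x = u \<or> x = u + 1)}"

fun z_check :: "nat \<Rightarrow> nat \<times> nat \<Rightarrow> qubit set" where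
  "z_check L (x, y) = {q. case q of
      Vert u v \<Rightarrow> v \<le> L \<and> (y = v + 1 \<and> u = x + 1 \<or> y = v \<and> u = x)
    | HEdge u v \<Rightarrow> v \<le> L \<and> u = x \<and> (y = v \<or> y = v + 1)
    | VEdge u v \<Rightarrow> v < L \<and> y = v + 1 \<and> (u = x \<or> u = x + 1)}"

abbreviation x_checks :: "nat \<Rightarrow> (nat \<times> nat) set" where
  "x_checks L \<equiv> {..Suc L} \<times> {..<L}"

abbreviation z_checks :: "nat \<Rightarrow> (nat \<times> nat) set" where
  "z_checks L \<equiv> {..<L} \<times> {..Suc L}"

lemma x_check_plaquette:
  "x < L \<Longrightarrow> x_check L (Suc x, y) = triangle SW (x, y) \<triangle> triangle NE (x, y)"
  by (rule qubit_set_eqI) auto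

lemma x_check_left: "x_check L (0, y) = {VEdge 0 y, Vert 0 (y + 1)}"
  by (rule qubit_set_eqI) auto

lemma x_check_right: "x_check L (Suc L, y) = {VEdge L y, Vert L y}"
  by (rule qubit_set_eqI) auto

lemma z_check_plaquette:
  "y < L \<Longrightarrow> z_check L (x, Suc y) = triangle SE (x, y) \<triangle> triangle NW (x, y)"
  by (rule qubit_set_eqI) auto

lemma z_check_bottom: "z_check L (x, 0) = {HEdge x 0, Vert x 0}"
  by (rule qubit_set_eqI) auto

lemma z_check_top: "z_check L (x, Suc L) = {HEdge x L, Vert (x + 1) L}"
  by (rule qubit_set_eqI) auto

lemma x_checks_cases:
  assumes "i \<in> x_checks L"
  obtains (left) y where "i = (0, y)" "y < L"
  | (right) y where "i = (Suc L, y)" "y < L"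
  | (plaquette) x y where "i = (Suc x, y)" "x < L" "y < L"
proof -
  obtain x y where i: "i = (x, y)" "x \<le> Suc L" "y < L" using assms by auto
  consider "x = 0" | "x = Suc L" | x' where "x = Suc x'" "x' < L"
    using i(2) by (cases x) (auto simp: less_le)
  then show ?thesis using i that by cases auto
qed

lemma z_checks_cases:
  assumes "i \<in> z_checks L"
  obtains (bottom) x where "i = (x, 0)" "x < L"
  | (top) x where "i = (x, Suc L)" "x < L"
  | (plaquette) x y where "i = (x, Suc y)" "x < L" "y < L"
proof -
  obtain x y where i: "i = (x, y)" "y \<le> Suc L" "x < L" using assms by auto
  consider "y = 0" | "y = Suc L" | y' where "y = Suc y'" "y' < L"
    using i(2) by (cases y) (auto simp: less_le)
  then show ?thesis using i that by cases auto
qed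

section \<open>Orthogonality of checks, triangles and lines\<close>

lemma x_check_subset: "i \<in> x_checks L \<Longrightarrow> x_check L i \<subseteq> qubits L"
  by (cases i; rule qubit_subsetI; auto)

lemma z_check_subset: "i \<in> z_checks L \<Longrightarrow> z_check L i \<subseteq> qubits L"
  by (cases i; rule qubit_subsetI; auto)

text \<open>A Z check that meets an X triangle contains exactly two of its three qubits, even when
  the check is cut off by the boundary.\<close>

lemma x_triangle_z_check:
  assumes "p \<in> plaquettes L" "i \<in> z_checks L"
  shows "\<not> odd_overlap (triangle SW p) (z_check L i)" "\<not> odd_overlap (triangle NE p) (z_check L i)"
  using assms by (cases p; cases i; force simp: plaquettes_def odd_overlap_insert)+

lemma x_check_z_triangle:
  assumes "i \<in> x_checks L" "p \<in> plaquettes L"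
  shows "\<not> odd_overlap (triangle SE p) (x_check L i)" "\<not> odd_overlap (triangle NW p) (x_check L i)"
  using assms by (cases p; cases i; force simp: plaquettes_def odd_overlap_insert)+

text \<open>In the same plaquette the two triangles share just the bottom edge. The only other SE
  triangle meeting the SW triangle of \<open>p\<close> is that of the western neighbour, which
  shares the vertex and the vertical edge, an even number.\<close>

lemma x_triangle_z_triangle:
  "odd_overlap (triangle SW p) (triangle SE q) \<longleftrightarrow> p = q"
  by (cases p; cases q) (auto simp: odd_overlap_insert)

text \<open>A plaquette check is the sum of two triangles, so bilinearity reduces it to the triangle
  case; only the boundary checks are inspected directly.\<close>

lemma x_check_z_check:
  assumes "i \<in> x_checks L" "k \<in> z_checks L"
  shows "\<not> odd_overlap (x_check L i) (z_check L k)"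
  using assms(1)
proof (cases rule: x_checks_cases)
  case (left y)
  then show ?thesis unfolding left x_check_left using assms(2)
    by (cases k) (auto simp: odd_overlap_insert)
next
  case (right y)
  then show ?thesis unfolding right x_check_right using assms(2)
    by (cases k) (auto simp: odd_overlap_insert)
next
  case (plaquette x y)
  then have "(x, y) \<in> plaquettes L" by (simp add: plaquettes_def)
  then show ?thesis unfolding plaquette(1) x_check_plaquette[OF plaquette(2)]
    using x_triangle_z_check[OF _ assms(2)] finite_triangle
    by (simp add: odd_overlap_sdiff del: triangle.simps)
qed

text \<open>Each X triangle, and each X check on the left or right boundary, meets a vertical line
  either not at all or in a vertex together with a vertical edge.\<close>

lemma x_check_vertical_line:
  assumes "i \<in> x_checks L"
  shows "\<not> odd_overlap (x_check L i) (vertical_line L x)"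
  using assms
proof (cases rule: x_checks_cases)
  case (plaquette u v)
  then show ?thesis unfolding plaquette(1) x_check_plaquette[OF plaquette(2)]
    using finite_triangle by (auto simp: odd_overlap_sdiff odd_overlap_insert)
qed (auto simp: odd_overlap_insert x_check_left x_check_right simp del: x_check.simps)

lemma z_check_horizontal_line:
  assumes "i \<in> z_checks L"
  shows "\<not> odd_overlap (z_check L i) (horizontal_line L y)"
  using assms
proof (cases rule: z_checks_cases)
  case (plaquette u v)
  then show ?thesis unfolding plaquette(1) z_check_plaquette[OF plaquette(3)]
    using finite_triangle by (auto simp: odd_overlap_sdiff odd_overlap_insert)
qed (auto simp: odd_overlap_insert z_check_bottom z_check_top simp del: z_check.simps)

lemma x_triangle_vertical_line:
  "p \<in> plaquettes L \<Longrightarrow> \<not> odd_overlap (triangle SW p) (vertical_line L x)"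
  by (cases p) (auto simp: plaquettes_def odd_overlap_insert)

lemma z_triangle_horizontal_line:
  "p \<in> plaquettes L \<Longrightarrow> \<not> odd_overlap (triangle SE p) (horizontal_line L y)"
  by (cases p) (auto simp: plaquettes_def odd_overlap_insert)

lemma horizontal_line_vertical_line:
  assumes "x \<le> L" "y \<le> L"
  shows "odd_overlap (horizontal_line L y) (vertical_line L x)"
proof -
  have "horizontal_line L y \<inter> vertical_line L x = {Vert x y}"
    by (rule qubit_set_eqI) (use assms in auto)
  then show ?thesis by (simp add: odd_overlap_def)
qed

section \<open>Linear relations among the checks\<close>

lemma xsum_eq_emptyD:
  assumes "xsum f K = {}" "\<And>i. i \<in> K \<Longrightarrow> q \<in> f i \<longleftrightarrow> i \<in> A"
  shows "\<not> odd_overlap A K"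
proof -
  have "q \<notin> xsum f K" using assms(1) by simp
  then have "even (card {i \<in> K. q \<in> f i})" by (simp add: xsum_def)
  \<comment> \<open>\<open>A\<close> lists the checks through \<open>q\<close>; the relation at
    coordinate \<open>q\<close> says that evenly many of them lie in \<open>K\<close>.\<close>
  moreover have "{i \<in> K. q \<in> f i} = A \<inter> K" using assms(2) by auto
  ultimately show ?thesis by (simp add: odd_overlap_def)
qed

text \<open>The vertical edges force the coefficients to be constant along each row of checks; the
  vertices then force them to vanish, from the bottom row upwards.\<close>

lemma x_check_indep:
  assumes K: "K \<subseteq> x_checks L" and zero: "xsum (x_check L) K = {}"
  shows "K = {}"
proof -
  have edge: "(u, v) \<in> K \<longleftrightarrow> (Suc u, v) \<in> K" if "u \<le> L" "v < L" for u v
  proof -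
    have "\<not> odd_overlap {(u, v), (Suc u, v)} K"
      by (rule xsum_eq_emptyD[OF zero, of "VEdge u v"]) (use that in auto)
    then show ?thesis by (simp add: odd_overlap_insert)
  qed
  have const: "(x, y) \<in> K \<longleftrightarrow> (0, y) \<in> K" if "x \<le> Suc L" "y < L" for x y
    using that by (induction x) (use edge in auto)
  have "(x, y) \<notin> K" if "x \<le> Suc L" "y < L" for x y
    using that
  proof (induction y arbitrary: x)
    case 0
    \<comment> \<open>The corner \<open>Vert 0 0\<close> lies in a single X check, since its second
      one would be in a row below the lattice. This starts the induction.\<close>
    have "\<not> odd_overlap {(Suc 0, 0)} K"
      by (rule xsum_eq_emptyD[OF zero, of "Vert 0 0"]) auto
    then show ?case using const[of x 0] const[of "Suc 0" 0] 0 by (simp add: odd_overlap_insert)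
  next
    case (Suc y)
    \<comment> \<open>\<open>Vert 0 (Suc y)\<close> links the row \<open>Suc y\<close> with the row
      \<open>y\<close>, which is already known to vanish.\<close>
    have "\<not> odd_overlap {(Suc 0, Suc y), (0, y)} K"
      by (rule xsum_eq_emptyD[OF zero, of "Vert 0 (Suc y)"]) auto
    then show ?case using const[of x "Suc y"] const[of "Suc 0" "Suc y"] Suc
      by (simp add: odd_overlap_insert)
  qed
  then show ?thesis using K by fastforce
qed

text \<open>The transposed argument: horizontal edges make coefficients constant along each column
  of checks, and vertices then eliminate the columns from left to right.\<close>

lemma z_check_indep:
  assumes K: "K \<subseteq> z_checks L" and zero: "xsum (z_check L) K = {}"
  shows "K = {}"
proof -
  have edge: "(u, v) \<in> K \<longleftrightarrow> (u, Suc v) \<in> K" if "u < L" "v \<le> L" for u v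
  proof -
    have "\<not> odd_overlap {(u, v), (u, Suc v)} K"
      by (rule xsum_eq_emptyD[OF zero, of "HEdge u v"]) (use that in auto)
    then show ?thesis by (simp add: odd_overlap_insert)
  qed
  have const: "(x, y) \<in> K \<longleftrightarrow> (x, 0) \<in> K" if "y \<le> Suc L" "x < L" for x y
    using that by (induction y) (use edge in auto)
  have "(x, y) \<notin> K" if "y \<le> Suc L" "x < L" for x y
    using that
  proof (induction x arbitrary: y)
    case 0
    have "\<not> odd_overlap {(0, 0)} K"
      by (rule xsum_eq_emptyD[OF zero, of "Vert 0 0"]) auto
    then show ?case using const[of y 0] 0 by (simp add: odd_overlap_insert)
  next
    case (Suc x)
    have "\<not> odd_overlap {(x, Suc 0), (Suc x, 0)} K"
      by (rule xsum_eq_emptyD[OF zero, of "Vert (Suc x) 0"]) auto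
    then show ?case using const[of y "Suc x"] Suc by (simp add: odd_overlap_insert)
  qed
  then show ?thesis using K by fastforce
qed

text \<open>In a full row of X checks, both boundary checks included, each vertical edge between the
  lines is covered twice and cancels, while every vertex and horizontal edge of the two lines is
  covered once.\<close>

lemma adjacent_horizontal_lines:
  assumes "y < L"
  shows "xsum (x_check L) ({..Suc L} \<times> {y}) = horizontal_line L y \<triangle> horizontal_line L (Suc y)"
proof (rule qubit_set_eqI)
  let ?K = "{..Suc L} \<times> {y}"
  fix u v
  have "{i \<in> ?K. Vert u v \<in> x_check L i} =
      (if u \<le> L \<and> v = y then {(Suc u, y)} else if u \<le> L \<and> v = Suc y then {(u, y)} else {})"
    by auto
  then show "Vert u v \<in> xsum (x_check L) ?K \<longleftrightarrow>
      Vert u v \<in> horizontal_line L y \<triangle> horizontal_line L (Suc y)" by (auto simp: xsum_def)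
  have "{i \<in> ?K. HEdge u v \<in> x_check L i} =
      (if u < L \<and> (v = y \<or> v = Suc y) then {(Suc u, y)} else {})"
    by auto
  then show "HEdge u v \<in> xsum (x_check L) ?K \<longleftrightarrow>
      HEdge u v \<in> horizontal_line L y \<triangle> horizontal_line L (Suc y)" by (auto simp: xsum_def)
  have "{i \<in> ?K. VEdge u v \<in> x_check L i} =
      (if u \<le> L \<and> v = y then {(u, y), (Suc u, y)} else {})"
    by auto
  then show "VEdge u v \<in> xsum (x_check L) ?K \<longleftrightarrow>
      VEdge u v \<in> horizontal_line L y \<triangle> horizontal_line L (Suc y)" by (auto simp: xsum_def)
qed

lemma adjacent_vertical_lines:
  assumes "x < L"
  shows "xsum (z_check L) ({x} \<times> {..Suc L}) = vertical_line L x \<triangle> vertical_line L (Suc x)"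
proof (rule qubit_set_eqI)
  let ?K = "{x} \<times> {..Suc L}"
  fix u v
  have "{i \<in> ?K. Vert u v \<in> z_check L i} =
      (if v \<le> L \<and> u = x then {(x, v)} else if v \<le> L \<and> u = Suc x then {(x, Suc v)} else {})"
    by auto
  then show "Vert u v \<in> xsum (z_check L) ?K \<longleftrightarrow>
      Vert u v \<in> vertical_line L x \<triangle> vertical_line L (Suc x)" by (auto simp: xsum_def)
  have "{i \<in> ?K. HEdge u v \<in> z_check L i} =
      (if v \<le> L \<and> u = x then {(x, v), (x, Suc v)} else {})"
    by auto
  then show "HEdge u v \<in> xsum (z_check L) ?K \<longleftrightarrow>
      HEdge u v \<in> vertical_line L x \<triangle> vertical_line L (Suc x)" by (auto simp: xsum_def)
  have "{i \<in> ?K. VEdge u v \<in> z_check L i} =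
      (if v < L \<and> (u = x \<or> u = Suc x) then {(x, Suc v)} else {})"
    by auto
  then show "VEdge u v \<in> xsum (z_check L) ?K \<longleftrightarrow>
      VEdge u v \<in> vertical_line L x \<triangle> vertical_line L (Suc x)" by (auto simp: xsum_def)
qed

section \<open>The surface code as an instance of the abstract code\<close>

definition logical_X_support :: "qubit set \<Rightarrow> (nat \<times> nat) option \<Rightarrow> qubit set" where
  "logical_X_support \<Gamma> i = (case i of Some p \<Rightarrow> triangle SW p | None \<Rightarrow> \<Gamma>)"

definition logical_Z_support :: "qubit set \<Rightarrow> (nat \<times> nat) option \<Rightarrow> qubit set" where
  "logical_Z_support \<Lambda> i = (case i of Some p \<Rightarrow> triangle SE p | None \<Rightarrow> \<Lambda>)"

lemma finite_x_check: "i \<in> x_checks L \<Longrightarrow> finite (x_check L i)"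
  and finite_z_check: "k \<in> z_checks L \<Longrightarrow> finite (z_check L k)"
  by (erule finite_subset[OF x_check_subset finite_qubits], erule finite_subset[OF z_check_subset finite_qubits])

lemma finite_plaquettes: "finite (plaquettes L)"
  and card_plaquettes: "card (plaquettes L) = L^2"
  by (simp_all add: plaquettes_def power2_eq_square)

lemma finite_encoded_qubits: "finite (gauge_qubits L \<union> logical_qubits)"
  and card_gauge_qubits: "card (gauge_qubits L) = L^2"
  and card_encoded_qubits: "card (gauge_qubits L \<union> logical_qubits) = L^2 + 1"
proof -
  show "finite (gauge_qubits L \<union> logical_qubits)"
    using finite_plaquettes by (simp add: gauge_qubits_def logical_qubits_def)
  show *: "card (gauge_qubits L) = L^2"
    by (simp add: gauge_qubits_def card_image card_plaquettes)
  have "gauge_qubits L \<inter> logical_qubits = {}" by (auto simp: gauge_qubits_def logical_qubits_def)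
  then show "card (gauge_qubits L \<union> logical_qubits) = L^2 + 1"
    using finite_plaquettes * by (subst card_Un_disjoint) (auto simp: gauge_qubits_def logical_qubits_def)
qed

lemma css_code_surface:
  assumes "x \<le> L" "y \<le> L"
  shows "css_code (qubits L) (x_checks L) (x_check L) (z_checks L) (z_check L)
    (gauge_qubits L \<union> logical_qubits)
    (logical_X_support (horizontal_line L y)) (logical_Z_support (vertical_line L x))"
proof
  let ?J = "gauge_qubits L \<union> logical_qubits"
  let ?lX = "logical_X_support (horizontal_line L y)" and ?lZ = "logical_Z_support (vertical_line L x)"
  have J: "j = None \<or> (\<exists>p\<in>plaquettes L. j = Some p)" if "j \<in> ?J" for j
    using that by (auto simp: gauge_qubits_def logical_qubits_def)
  show "finite (qubits L)" "finite (x_checks L)" "finite (z_checks L)" "finite ?J"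
    using finite_qubits finite_encoded_qubits by auto
  show "card (qubits L) = card (x_checks L) + card (z_checks L) + card ?J"
    by (simp add: card_qubits card_encoded_qubits power2_eq_square algebra_simps)
  show "x_check L i \<subseteq> qubits L" if "i \<in> x_checks L" for i using that by (rule x_check_subset)
  show "z_check L i \<subseteq> qubits L" if "i \<in> z_checks L" for i using that by (rule z_check_subset)
  show "\<not> odd_overlap (x_check L i) (z_check L k)" if "i \<in> x_checks L" "k \<in> z_checks L" for i k
    using that by (rule x_check_z_check)
  show "K = {}" if "K \<subseteq> x_checks L" "xsum (x_check L) K = {}" for K using that by (rule x_check_indep)
  show "K = {}" if "K \<subseteq> z_checks L" "xsum (z_check L) K = {}" for K using that by (rule z_check_indep)
  show "?lX j \<subseteq> qubits L" "?lZ j \<subseteq> qubits L" if "j \<in> ?J" for j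
    using J[OF that] horizontal_line_subset[OF assms(2)] vertical_line_subset[OF assms(1)]
      triangle_subset[THEN subsetD]
    by (auto simp: logical_X_support_def logical_Z_support_def simp del: triangle.simps)
  show "\<not> odd_overlap (x_check L i) (?lZ j)" if "i \<in> x_checks L" "j \<in> ?J" for i j
    using J[OF that(2)] x_check_vertical_line[OF that(1)] x_check_z_triangle(1)[OF that(1)]
    by (auto simp: logical_Z_support_def odd_overlap_commute simp del: triangle.simps)
  show "\<not> odd_overlap (z_check L k) (?lX j)" if "k \<in> z_checks L" "j \<in> ?J" for k j
    using J[OF that(2)] z_check_horizontal_line[OF that(1)] x_triangle_z_check(1)[OF _ that(1)]
    by (auto simp: logical_X_support_def odd_overlap_commute simp del: triangle.simps)
  \<comment> \<open>Two gauge qubits are handled by the triangle overlaps; a triangle meets the line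
    of the opposite type evenly; the two lines cross in exactly one vertex.\<close>
  show "odd_overlap (?lX j) (?lZ j') \<longleftrightarrow> j = j'" if "j \<in> ?J" "j' \<in> ?J" for j j'
    using J[OF that(1)] J[OF that(2)] horizontal_line_vertical_line[OF assms]
      x_triangle_vertical_line[of _ L x] z_triangle_horizontal_line[of _ L y] x_triangle_z_triangle
    by (auto simp: logical_X_support_def logical_Z_support_def
        odd_overlap_commute[of "horizontal_line L y" "triangle SE _"] simp del: triangle.simps)
qed

section \<open>Operators of the code in normal form\<close>

lemma plaquette_stab_X_eq:
  assumes "x < L"
  shows "plaquette_stab_X (x, y) = pauli_op 0 (x_check L (Suc x, y)) {}"
  unfolding plaquette_stab_X_def x_check_plaquette[OF assms] triangle_op.simps
  by (simp add: X_on_eq_pauli_op finite_triangle pauli_op_comp del: triangle.simps)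

lemma plaquette_stab_Z_eq:
  assumes "y < L"
  shows "plaquette_stab_Z (x, y) = pauli_op 0 {} (z_check L (x, Suc y))"
  unfolding plaquette_stab_Z_def z_check_plaquette[OF assms] triangle_op.simps
  by (simp add: Z_on_eq_pauli_op finite_triangle pauli_op_comp del: triangle.simps)

lemma boundary_stabs_eq:
  "boundary_stabs L = {pauli_op 0 (x_check L (0, y)) {} | y. y < L} \<union>
     {pauli_op 0 (x_check L (Suc L, y)) {} | y. y < L} \<union>
     {pauli_op 0 {} (z_check L (x, Suc L)) | x. x < L} \<union>
     {pauli_op 0 {} (z_check L (x, 0)) | x. x < L}"
  unfolding boundary_stabs_def x_check_left x_check_right z_check_bottom z_check_top
  by (simp add: X_on_eq_pauli_op Z_on_eq_pauli_op)

lemma stab_generators_eq: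
  "stab_generators L = css_generators (x_check L) (x_checks L) (z_check L) (z_checks L)"
proof
  have "pauli_op 0 (x_check L i) {} \<in> stab_generators L" if "i \<in> x_checks L" for i
    using that
  proof (cases rule: x_checks_cases)
    case (plaquette x y)
    then have "(x, y) \<in> plaquettes L" by (simp add: plaquettes_def)
    then show ?thesis unfolding plaquette(1) plaquette_stab_X_eq[OF plaquette(2), symmetric]
      by (simp add: stab_generators_def)
  qed (auto simp: stab_generators_def boundary_stabs_eq simp del: x_check.simps z_check.simps)
  moreover have "pauli_op 0 {} (z_check L i) \<in> stab_generators L" if "i \<in> z_checks L" for i
    using that
  proof (cases rule: z_checks_cases)
    case (plaquette x y)
    then have "(x, y) \<in> plaquettes L" by (simp add: plaquettes_def)
    then show ?thesis unfolding plaquette(1) plaquette_stab_Z_eq[OF plaquette(3), symmetric]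
      by (simp add: stab_generators_def)
  qed (auto simp: stab_generators_def boundary_stabs_eq simp del: x_check.simps z_check.simps)
  ultimately show "css_generators (x_check L) (x_checks L) (z_check L) (z_checks L) \<subseteq> stab_generators L"
    unfolding css_generators_def by (intro Un_least image_subsetI)
  have X: "pauli_op 0 (x_check L i) {} \<in> css_generators (x_check L) (x_checks L) (z_check L) (z_checks L)"
    if "i \<in> x_checks L" for i using that by (auto simp: css_generators_def)
  have Z: "pauli_op 0 {} (z_check L i) \<in> css_generators (x_check L) (x_checks L) (z_check L) (z_checks L)"
    if "i \<in> z_checks L" for i using that by (auto simp: css_generators_def)
  show "stab_generators L \<subseteq> css_generators (x_check L) (x_checks L) (z_check L) (z_checks L)"
    unfolding stab_generators_def boundary_stabs_eq
    by (auto simp: plaquettes_def plaquette_stab_X_eq plaquette_stab_Z_eq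
        simp del: x_check.simps z_check.simps intro!: X Z)
qed

lemma boundary_stab_commute_triangle_op:
  assumes S: "S \<in> boundary_stabs L" and p: "p \<in> plaquettes L"
  shows "commute S (triangle_op u p)"
proof -
  consider i where "i \<in> x_checks L" "S = pauli_op 0 (x_check L i) {}"
    | k where "k \<in> z_checks L" "S = pauli_op 0 {} (z_check L k)"
    using S unfolding boundary_stabs_eq by force
  then show ?thesis
  proof cases
    case 1
    then show ?thesis using x_check_z_triangle[OF 1(1) p]
      by (cases u) (simp_all add: X_on_eq_pauli_op Z_on_eq_pauli_op finite_triangle commute_pauli_op
          odd_overlap_commute[of "x_check L i"] del: triangle.simps x_check.simps)
  next
    case 2
    then show ?thesis using x_triangle_z_check[OF p 2(1)] finite_z_check[OF 2(1)]
      by (cases u) (simp_all add: X_on_eq_pauli_op Z_on_eq_pauli_op finite_triangle commute_pauli_op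
          del: triangle.simps z_check.simps)
  qed
qed

lemma encoded_X_eq:
  assumes "finite \<Gamma>"
  shows "encoded_X \<Gamma> = (\<lambda>j. pauli_op 0 (logical_X_support \<Gamma> j) {})"
  using assms by (auto simp: encoded_X_def logical_X_support_def X_on_eq_pauli_op finite_triangle
      split: option.split simp del: triangle.simps)

lemma encoded_Z_eq:
  assumes "finite \<Lambda>"
  shows "encoded_Z \<Lambda> = (\<lambda>j. pauli_op 0 {} (logical_Z_support \<Lambda> j))"
  using assms by (auto simp: encoded_Z_def logical_Z_support_def Z_on_eq_pauli_op finite_triangle
      split: option.split simp del: triangle.simps)

text \<open>A bottom operator acts on the left endpoint of its edge and so reaches every column
  except the last; column \<open>L\<close> is reached by a top operator, which acts on the right
  endpoint. Either one meets the line in a vertex only.\<close>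

lemma X_on_vertical_line_anticommute:
  assumes "L \<ge> 1" "x \<le> L"
  shows "\<exists>S\<in>boundary_stabs L. anticommute (X_on (vertical_line L x)) S"
proof -
  have fin: "finite (vertical_line L x)"
    using vertical_line_subset[OF assms(2)] finite_qubits by (rule finite_subset)
  obtain k where k: "pauli_op 0 {} (z_check L k) \<in> boundary_stabs L" "finite (z_check L k)"
    "odd_overlap (vertical_line L x) (z_check L k)"
  proof (cases "x = L")
    case True
    then obtain u where u: "L = Suc u" using assms(1) by (cases L) auto
    show thesis
    proof (rule that[of "(u, Suc L)"])
      show "pauli_op 0 {} (z_check L (u, Suc L)) \<in> boundary_stabs L"
        unfolding boundary_stabs_eq using u by blast
      have "odd_overlap {HEdge u L, Vert (u + 1) L} (vertical_line L x)"
        using True u by (simp add: odd_overlap_insert)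
      then show "odd_overlap (vertical_line L x) (z_check L (u, Suc L))"
        unfolding z_check_top by (subst odd_overlap_commute)
      show "finite (z_check L (u, Suc L))" unfolding z_check_top by simp
    qed
  next
    case False
    show thesis
    proof (rule that[of "(x, 0)"])
      show "pauli_op 0 {} (z_check L (x, 0)) \<in> boundary_stabs L"
        unfolding boundary_stabs_eq using False le_neq_implies_less[OF assms(2)] by blast
      have "odd_overlap {HEdge x 0, Vert x 0} (vertical_line L x)"
        by (simp add: odd_overlap_insert)
      then show "odd_overlap (vertical_line L x) (z_check L (x, 0))"
        unfolding z_check_bottom by (subst odd_overlap_commute)
      show "finite (z_check L (x, 0))" unfolding z_check_bottom by simp
    qed
  qed
  then show ?thesis using fin
    by (auto intro!: bexI[OF _ k(1)] simp: X_on_eq_pauli_op anticommute_pauli_op simp del: z_check.simps)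
qed

text \<open>Left operators act on upper endpoints and reach every row except 0; row 0 is reached by
  a right operator, which acts on the lower endpoint.\<close>

lemma Z_on_horizontal_line_anticommute:
  assumes "L \<ge> 1" "y \<le> L"
  shows "\<exists>S\<in>boundary_stabs L. anticommute (Z_on (horizontal_line L y)) S"
proof -
  have fin: "finite (horizontal_line L y)"
    using horizontal_line_subset[OF assms(2)] finite_qubits by (rule finite_subset)
  obtain k where k: "pauli_op 0 (x_check L k) {} \<in> boundary_stabs L"
    "odd_overlap (x_check L k) (horizontal_line L y)"
  proof (cases y)
    case 0
    show thesis
    proof (rule that[of "(Suc L, 0)"])
      show "pauli_op 0 (x_check L (Suc L, 0)) {} \<in> boundary_stabs L"
        unfolding boundary_stabs_eq using assms(1) by (auto simp del: x_check.simps z_check.simps)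
    qed (unfold x_check_right, use 0 in \<open>auto simp: odd_overlap_insert\<close>)
  next
    case (Suc v)
    show thesis
    proof (rule that[of "(0, v)"])
      show "pauli_op 0 (x_check L (0, v)) {} \<in> boundary_stabs L"
        unfolding boundary_stabs_eq using Suc assms(2) by (auto simp del: x_check.simps z_check.simps)
    qed (unfold x_check_left, use Suc in \<open>auto simp: odd_overlap_insert\<close>)
  qed
  then show ?thesis using fin
    by (auto intro!: bexI[OF _ k(1)] simp: Z_on_eq_pauli_op anticommute_pauli_op simp del: x_check.simps)
qed

lemma not_commute_if_anticommute:
  assumes "finite b" "finite b'"
  shows "anticommute (pauli_op k a b) (pauli_op k' a' b') \<Longrightarrow> \<not> commute (pauli_op k a b) (pauli_op k' a' b')"
  using assms by (simp add: anticommute_pauli_op commute_pauli_op)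

section \<open>The minimum distance\<close>

lemma odd_overlap_horizontal_lines:
  assumes b: "b \<subseteq> qubits L" "\<And>i. i \<in> x_checks L \<Longrightarrow> \<not> odd_overlap (x_check L i) b" and "y \<le> L"
  shows "odd_overlap (horizontal_line L y) b \<longleftrightarrow> odd_overlap (horizontal_line L 0) b"
  using \<open>y \<le> L\<close>
proof (induction y)
  case (Suc y)
  have fin: "finite (horizontal_line L v)" if "v \<le> L" for v
    using horizontal_line_subset[OF that] finite_qubits by (rule finite_subset)
  \<comment> \<open>The sum of these checks is the difference of the lines \<open>y\<close> and
    \<open>Suc y\<close>, so both lines overlap \<open>b\<close> with the same parity.\<close>
  have "\<not> odd_overlap (xsum (x_check L) ({..Suc L} \<times> {y})) b"
    by (rule not_odd_overlap_xsum)
      (use Suc b finite_x_check in \<open>auto simp del: x_check.simps\<close>)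
  then show ?case using Suc fin[of y] fin[of "Suc y"]
    by (simp add: adjacent_horizontal_lines odd_overlap_sdiff)
qed simp

lemma odd_overlap_vertical_lines:
  assumes a: "a \<subseteq> qubits L" "\<And>i. i \<in> z_checks L \<Longrightarrow> \<not> odd_overlap (z_check L i) a" and "x \<le> L"
  shows "odd_overlap (vertical_line L x) a \<longleftrightarrow> odd_overlap (vertical_line L 0) a"
  using \<open>x \<le> L\<close>
proof (induction x)
  case (Suc x)
  have fin: "finite (vertical_line L u)" if "u \<le> L" for u
    using vertical_line_subset[OF that] finite_qubits by (rule finite_subset)
  have "\<not> odd_overlap (xsum (z_check L) ({x} \<times> {..Suc L})) a"
    by (rule not_odd_overlap_xsum)
      (use Suc a finite_z_check in \<open>auto simp del: z_check.simps\<close>)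
  then show ?case using Suc fin[of x] fin[of "Suc x"]
    by (simp add: adjacent_vertical_lines odd_overlap_sdiff)
qed simp

text \<open>The label \<open>f\<close> makes distinct lines disjoint, and an odd overlap is
  nonempty; so \<open>f\<close> maps \<open>A\<close> onto at least \<open>L + 1\<close>
  values.\<close>

lemma card_ge_if_meets_all:
  fixes line :: "nat \<Rightarrow> 'a set"
  assumes "finite A" "\<And>y. y \<le> L \<Longrightarrow> odd_overlap (line y) A" "\<And>q y. q \<in> line y \<Longrightarrow> f q = y"
  shows "L + 1 \<le> card A"
proof -
  have "{..L} \<subseteq> f ` A"
  proof
    fix y assume "y \<in> {..L}"
    then have "line y \<inter> A \<noteq> {}" using assms(2)[of y] by (auto simp: odd_overlap_def)
    then show "y \<in> f ` A" using assms(3) by force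
  qed
  then have "card {..L} \<le> card (f ` A)" using assms(1) by (intro card_mono) auto
  also have "\<dots> \<le> card A" using assms(1) by (rule card_image_le)
  finally show ?thesis by simp
qed

fun column :: "qubit \<Rightarrow> nat" where
  "column (Vert u v) = u" | "column (HEdge u v) = u" | "column (VEdge u v) = u"

fun row :: "qubit \<Rightarrow> nat" where
  "row (Vert u v) = v" | "row (HEdge u v) = v" | "row (VEdge u v) = v"

lemma row_horizontal_line: "q \<in> horizontal_line L y \<Longrightarrow> row q = y"
  by (cases q) auto

lemma column_vertical_line: "q \<in> vertical_line L x \<Longrightarrow> column q = x"
  by (cases q) auto

lemma minimum_distance_surface:
  assumes L: "L \<ge> 1" and "x \<le> L" "y \<le> L"
  shows "minimum_distance (qubits L) (stab_group L)
    {X_on (horizontal_line L y), Z_on (vertical_line L x)} = L + 1"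
proof -
  interpret css_code "qubits L" "x_checks L" "x_check L" "z_checks L" "z_check L"
    "gauge_qubits L \<union> logical_qubits" "logical_X_support (horizontal_line L y)"
    "logical_Z_support (vertical_line L x)"
    using assms(2,3) by (rule css_code_surface)
  have stabs: "stab_group L = stabs" unfolding stab_group_def stabs_def stab_generators_eq by (rule refl)
  have fin: "finite (horizontal_line L y)" "finite (vertical_line L x)"
    using assms horizontal_line_subset vertical_line_subset finite_subset_Q by auto
  define D where "D = {weight E | E. pauli_support E \<subseteq> qubits L \<and>
    (\<forall>A\<in>stab_group L. commute (pauli_string E) A) \<and>
    (\<exists>A\<in>{X_on (horizontal_line L y), Z_on (vertical_line L x)}. anticommute (pauli_string E) A)}"
  have "L + 1 \<le> w" if "w \<in> D" for w
  proof -
    from that obtain E where w: "w = weight E" and E: "pauli_support E \<subseteq> qubits L"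
      and comm: "\<forall>A\<in>stabs. commute (pauli_string E) A"
      and anti: "anticommute (pauli_string E) (X_on (horizontal_line L y)) \<or>
        anticommute (pauli_string E) (Z_on (vertical_line L x))"
      by (auto simp: D_def stabs)
    have finE: "finite (pauli_support E)" using E by (rule finite_subset_Q)
    note E_eq = pauli_string_eq_pauli_op[OF finE]
    have parts: "x_part E \<subseteq> pauli_support E" "z_part E \<subseteq> pauli_support E"
      by (auto simp: x_part_def z_part_def pauli_support_def)
    have sub: "x_part E \<subseteq> qubits L" "z_part E \<subseteq> qubits L" using parts E by auto
    have "pauli_string E \<in> logical_operators (qubits L) stabs"
      using comm sub unfolding logical_operators_def E_eq carrier_pauli_group[OF finite_qubits] by blast
    then have orth: "\<And>k. k \<in> z_checks L \<Longrightarrow> \<not> odd_overlap (z_check L k) (x_part E)"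
      "\<And>i. i \<in> x_checks L \<Longrightarrow> \<not> odd_overlap (x_check L i) (z_part E)"
      unfolding E_eq pauli_op_in_logical_operators_iff[OF sub] odd_overlap_commute[of "x_part E"]
      by blast+
    have finp: "finite (x_part E)" "finite (z_part E)" using sub finite_subset_Q by auto
    \<comment> \<open>An error that anti-commutes with the X line overlaps that line oddly in its Z
      part, hence overlaps every horizontal line oddly; the other case uses the X part and vertical
      lines.\<close>
    from anti have "L + 1 \<le> card (z_part E) \<or> L + 1 \<le> card (x_part E)"
    proof
      assume "anticommute (pauli_string E) (X_on (horizontal_line L y))"
      then have "odd_overlap (horizontal_line L y) (z_part E)"
        using fin finp by (simp add: E_eq X_on_eq_pauli_op anticommute_pauli_op)
      then have "odd_overlap (horizontal_line L v) (z_part E)" if "v \<le> L" for v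
        using odd_overlap_horizontal_lines[OF sub(2) orth(2)] that assms(3) by blast
      then have "L + 1 \<le> card (z_part E)"
        using row_horizontal_line
        by (rule card_ge_if_meets_all[OF finp(2), where line = "horizontal_line L"])
      then show ?thesis ..
    next
      assume "anticommute (pauli_string E) (Z_on (vertical_line L x))"
      then have "odd_overlap (vertical_line L x) (x_part E)"
        using fin finp by (simp add: E_eq Z_on_eq_pauli_op anticommute_pauli_op odd_overlap_commute)
      then have "odd_overlap (vertical_line L u) (x_part E)" if "u \<le> L" for u
        using odd_overlap_vertical_lines[OF sub(1) orth(1)] that assms(2) by blast
      then have "L + 1 \<le> card (x_part E)"
        using column_vertical_line
        by (rule card_ge_if_meets_all[OF finp(1), where line = "vertical_line L"])
      then show ?thesis ..
    qed
    moreover have "card (x_part E) \<le> w" "card (z_part E) \<le> w"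
      unfolding w weight_def using parts finE by (auto intro: card_mono)
    ultimately show ?thesis by linarith
  qed
  moreover have "L + 1 \<in> D"
  proof -
    \<comment> \<open>This is the bottom line times the SW triangles of the bottom row: each
      triangle replaces \<open>Vert u 0\<close> and \<open>HEdge u 0\<close> by
      \<open>VEdge u 0\<close>, and only \<open>Vert L 0\<close> survives from the line. One qubit
      per column remains.\<close>
    define A where "A = insert (Vert L 0) ((\<lambda>u. VEdge u 0) ` {..<L})"
    define E where "E = (\<lambda>j. if j \<in> A then PX else PI)"
    have mem [simp]: "Vert u v \<in> A \<longleftrightarrow> u = L \<and> v = 0" "VEdge u v \<in> A \<longleftrightarrow> u < L \<and> v = 0"
      "HEdge u v \<notin> A" for u v
      by (auto simp: A_def)
    have A: "A \<subseteq> qubits L" by (rule qubit_subsetI) (use L in auto)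
    have finA: "finite A" using A by (rule finite_subset_Q)
    have cardA: "card A = L + 1"
      unfolding A_def by (subst card_insert_disjoint) (auto simp: card_image inj_on_def)
    have supp: "pauli_support E = A" by (auto simp: pauli_support_def E_def)
    have E: "pauli_string E = pauli_op 0 A {}"
      using X_on_eq_pauli_op[OF finA] by (simp add: X_on_def E_def)
    have "\<not> odd_overlap A (z_check L k)" if "k \<in> z_checks L" for k
    proof -
      obtain u v where k: "k = (u, v)" "u < L" using \<open>k \<in> z_checks L\<close> by auto
      \<comment> \<open>Only plaquette checks of the bottom row meet \<open>A\<close>, each in its
        left and right vertical edge; in the last plaquette \<open>Vert L 0\<close> takes the place
        of the right edge.\<close>
      have "A \<inter> z_check L k =
          (if v = 1 then {VEdge u 0, if Suc u = L then Vert L 0 else VEdge (Suc u) 0} else {})"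
        by (rule qubit_set_eqI) (use k in auto)
      then show ?thesis by (auto simp: odd_overlap_def)
    qed
    then have "pauli_op 0 A {} \<in> logical_operators (qubits L) stabs"
      using A by (subst pauli_op_in_logical_operators_iff) auto
    then have "\<forall>B\<in>stab_group L. commute (pauli_string E) B"
      by (simp add: logical_operators_def E stabs)
    moreover have "A \<inter> vertical_line L x = {if x = L then Vert L 0 else VEdge x 0}"
      by (rule qubit_set_eqI) (use assms in auto)
    then have "odd_overlap A (vertical_line L x)" by (simp add: odd_overlap_def)
    then have "anticommute (pauli_string E) (Z_on (vertical_line L x))"
      using fin by (simp add: E Z_on_eq_pauli_op anticommute_pauli_op)
    moreover have "weight E = L + 1" by (simp add: weight_def supp cardA)
    ultimately show ?thesis unfolding D_def using supp A by (intro CollectI exI[of _ E]) auto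
  qed
  ultimately have "Inf D = L + 1" by (intro cInf_eq_minimum)
  then show ?thesis by (simp add: minimum_distance_def D_def)
qed

theorem mainTheorem5:
  fixes L x y :: nat and \<Gamma> \<Lambda> :: "qubit set"
  assumes "L \<ge> 1"
    and "y \<le> L" and "\<Gamma> = horizontal_line L y"
    and "x \<le> L" and "\<Lambda> = vertical_line L x"
  shows
    "card (qubits L) = 3 * L^2 + 4 * L + 1 \<and>
     comm_group (pauli_group (qubits L)\<lparr>carrier := stab_group L\<rparr>) \<and>
     card (stab_generators L) = 2 * L^2 + 4 * L \<and>
     independent_generators (qubits L) (stab_generators L) \<and>
     stabilizer_code (qubits L) (stab_group L) (card (qubits L) - card (stab_generators L)) \<and>
     card (qubits L) - card (stab_generators L) = L^2 + 1 \<and>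
     (\<forall>S\<in>boundary_stabs L. \<forall>p\<in>plaquettes L. \<forall>u. commute S (triangle_op u p)) \<and>
     card (gauge_qubits L) = L^2 \<and> card logical_qubits = 1 \<and>
     logical_paulis (qubits L) (stab_group L) (gauge_qubits L \<union> logical_qubits)
       (encoded_X \<Gamma>) (encoded_Z \<Lambda>) \<and>
     X_on \<Lambda> \<notin> logical_operators (qubits L) (stab_group L) \<and>
     (\<exists>S\<in>boundary_stabs L. anticommute (X_on \<Lambda>) S) \<and>
     Z_on \<Gamma> \<notin> logical_operators (qubits L) (stab_group L) \<and>
     (\<exists>S\<in>boundary_stabs L. anticommute (Z_on \<Gamma>) S) \<and>
     minimum_distance (qubits L) (stab_group L) {X_on \<Gamma>, Z_on \<Lambda>} = L + 1"
proof -
  \<comment> \<open>The gauge qubits and the logical qubit form one index set, so a single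
    interpretation yields the Pauli relations among all of them and the completeness of the whole
    family.\<close>
  interpret css_code "qubits L" "x_checks L" "x_check L" "z_checks L" "z_check L"
    "gauge_qubits L \<union> logical_qubits" "logical_X_support \<Gamma>" "logical_Z_support \<Lambda>"
    unfolding assms using assms by (intro css_code_surface)
  have stabs: "stab_group L = stabs" unfolding stab_group_def stabs_def stab_generators_eq by (rule refl)
  have fin: "finite \<Gamma>" "finite \<Lambda>"
    using assms horizontal_line_subset vertical_line_subset finite_subset_Q by auto
  have card_gens: "card (stab_generators L) = 2 * L^2 + 4 * L"
    unfolding stab_generators_eq card_css_generators
    by (simp add: power2_eq_square algebra_simps)
  then have k: "card (qubits L) - card (stab_generators L) = L^2 + 1" by (simp add: card_qubits)
  have boundary: "S \<in> stabs" if "S \<in> boundary_stabs L" for S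
    using that unfolding stabs[symmetric] stab_group_def
    by (intro generate.incl) (simp add: stab_generators_def)
  have X: "\<exists>S\<in>boundary_stabs L. anticommute (X_on \<Lambda>) S"
    unfolding assms(5) using assms(1,4) by (rule X_on_vertical_line_anticommute)
  have Z: "\<exists>S\<in>boundary_stabs L. anticommute (Z_on \<Gamma>) S"
    unfolding assms(3) using assms(1,2) by (rule Z_on_horizontal_line_anticommute)
  \<comment> \<open>Boundary operators belong to the stabilizer group, and for Pauli operators
    anti-commuting excludes commuting, because the two are decided by opposite parities.\<close>
  have not_log: "pauli_op 0 a b \<notin> logical_operators (qubits L) stabs"
    if S: "\<exists>S\<in>boundary_stabs L. anticommute (pauli_op 0 a b) S" and "finite b" for a b
  proof
    assume log: "pauli_op 0 a b \<in> logical_operators (qubits L) stabs"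
    from S obtain S where S: "S \<in> stabs" "anticommute (pauli_op 0 a b) S" using boundary by blast
    then obtain a' b' where "S = pauli_op 0 a' b'" "finite b'" using finite_xspan_gZ unfolding stabs_eq by blast
    with S log \<open>finite b\<close> show False
      using not_commute_if_anticommute[of b b'] by (auto simp: logical_operators_def)
  qed
  have "X_on \<Lambda> \<notin> logical_operators (qubits L) stabs"
    using not_log[of \<Lambda> "{}"] X fin by (simp add: X_on_eq_pauli_op)
  moreover have "Z_on \<Gamma> \<notin> logical_operators (qubits L) stabs"
    using not_log[of "{}" \<Gamma>] Z fin by (simp add: Z_on_eq_pauli_op)
  moreover have "logical_paulis (qubits L) stabs (gauge_qubits L \<union> logical_qubits)
      (encoded_X \<Gamma>) (encoded_Z \<Lambda>)"
    unfolding encoded_X_eq[OF fin(1)] encoded_Z_eq[OF fin(2)] by (rule logical_paulis_stabs)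
  moreover have "stabilizer_code (qubits L) stabs (card (qubits L) - card (stab_generators L))"
    using stabilizer_code_stabs unfolding k card_encoded_qubits .
  moreover have "independent_generators (qubits L) (stab_generators L)"
    unfolding stab_generators_eq by (rule independent_css_generators)
  moreover have "minimum_distance (qubits L) stabs {X_on \<Gamma>, Z_on \<Lambda>} = L + 1"
    using minimum_distance_surface[OF assms(1,4,2)] unfolding assms(3,5) stabs[unfolded assms(3,5)] .
  ultimately show ?thesis
    unfolding stabs using card_qubits comm_group_stabs card_gens k card_gauge_qubits X Z
      boundary_stab_commute_triangle_op by (simp add: logical_qubits_def)
qed

end
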